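(* Let $X$ and $Y$ be topological spaces that are connected by projections and twists. Then the Loday functors $\mathcal{L}_{C(X)}$ and $\mathcal{L}_{C(Y)}$ are isomorphic (as functors $\Omega\to\mathrm{Vect}_{\mathbb{C}}$).
   Context: $\mathbb{N}=\{1,2,\dots\}$. For a topological space $X$, $C(X)$ is the $\mathbb{C}$-algebra of continuous functions $X\to\mathbb{C}$. Loday functor: $\Omega$ is the category whose objects are the sets $\langle n\rangle=\{1,\dots,n\}$, $n\in\mathbb{N}$, and whose morphisms are surjective maps. $\mathrm{Vect}_{\mathbb{C}}$ is the category of complex vector spaces. For a commutative (not necessarily unital) $\mathbb{C}$-algebra $A$, the Loday functor $\mathcal{L}_A:\Omega\to\mathrm{Vect}_{\mathbb{C}}$ takes $\langle n\rangle$ to the algebraic tensor power $A^{\otimes n}$ over $\mathbb{C}$ and a surjection $\sigma:\langle n\rangle\to\langle m\rangle$ to the linear map $\sigma^*:A^{\otimes n}\to A^{\otimes m}$, $a_1\otimes\dots\otimes a_n\mapsto b_1\otimes\dots\otimes b_m$, where $b_j=\prod_{i\in\sigma^{-1}(j)}a_i$. Projections and twists: for topological spaces $X$ and $Y$, a set of projections and twists is a collection of continuous maps $p_n:X\to X$, $q_n:Y\to Y$, $h_n:X\to Y$, $\bar h_n:Y\to X$ ($n\in\mathbb{N}$) such that, for all $i,j,n\in\mathbb{N}$: (1) $p_n\circ p_n=p_n$, $p_i\circ p_j=p_j\circ p_i$, $q_n\circ q_n=q_n$, $q_i\circ q_j=q_j\circ q_i$; the sets $\mathrm{Mov}(p_n)=\{x\in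 X\mid p_n(x)\ne x\}$, $n\in\mathbb{N}$, are pairwise disjoint, and the sets $\mathrm{Mov}(q_n)=\{y\in Y\mid q_n(y)\neq y\}$, $n\in\mathbb{N}$, are pairwise disjoint; (2) $q_j\circ h_i=h_i\circ p_j$, $p_j\circ\bar h_i=\bar h_i\circ q_j$, $\bar h_j\circ h_i=p_j\circ p_i$, $h_i\circ\bar h_j=q_i\circ q_j$. If such a collection exists, $X$ and $Y$ are said to be connected by projections and twists. *)

theory Defs
  imports
    "HOL-Analysis.Abstract_Limits"
    "HOL-Library.Poly_Mapping"
    "HOL-Algebra.AbelCoset"
    "Jordan_Normal_Form.VS_Connect"
begin

section \<open>The algebra of continuous functions\<close>

text \<open>Functions are taken to be extensional, so that two elements of \<open>C(X)\<close> are equal as soon as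
  they agree on the points of \<open>X\<close>.\<close>

definition continuous_functions :: "'a topology \<Rightarrow> (complex, 'a \<Rightarrow> complex) module" where
  "continuous_functions X =
    \<lparr>carrier = {f \<in> extensional (topspace X). continuous_map X euclidean f},
     mult = (\<lambda>f g. \<lambda>x\<in>topspace X. f x * g x),
     one = (\<lambda>x\<in>topspace X. 1),
     zero = (\<lambda>x\<in>topspace X. 0),
     add = (\<lambda>f g. \<lambda>x\<in>topspace X. f x + g x),
     smult = (\<lambda>c f. \<lambda>x\<in>topspace X. c * f x)\<rparr>"

section \<open>Tensor powers\<close>

text \<open>Vector spaces are the \<^const>\<open>vectorspace\<close>s over \<^term>\<open>class_ring :: complex ring\<close>.
  The fields \<^const>\<open>mult\<close> and \<^const>\<open>one\<close> of a record representing a vector space are irrelevant.\<close>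

definition free_space :: "'b set \<Rightarrow> (complex, 'b \<Rightarrow>\<^sub>0 complex) module" where
  "free_space S =
    \<lparr>carrier = {u. Poly_Mapping.keys u \<subseteq> S},
     mult = undefined, one = undefined,
     zero = 0, add = (+),
     smult = (\<lambda>c. Poly_Mapping.map ((*) c))\<rparr>"

definition free_space_map :: "('b \<Rightarrow> 'c) \<Rightarrow> ('b \<Rightarrow>\<^sub>0 complex) \<Rightarrow> ('c \<Rightarrow>\<^sub>0 complex)" where
  "free_space_map f u =
    (\<Sum>a\<in>Poly_Mapping.keys u. Poly_Mapping.single (f a) (Poly_Mapping.lookup u a))"

text \<open>In the scalar multiple of a coset \<open>U\<close> the summand \<open>N\<close> only matters for the scalar \<open>0\<close>, where the
  image of \<open>U\<close> alone would be \<open>{0}\<close> instead of \<open>N\<close>.\<close>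

definition quotient_space :: "('k, 'v, 'm) module_scheme \<Rightarrow> 'v set \<Rightarrow> ('k, 'v set) module" where
  "quotient_space V N =
    \<lparr>carrier = a_rcosets\<^bsub>V\<^esub> N,
     mult = undefined, one = undefined,
     zero = N, add = set_add V,
     smult = (\<lambda>c U. N <+>\<^bsub>V\<^esub> ((\<lambda>u. c \<odot>\<^bsub>V\<^esub> u) ` U))\<rparr>"

text \<open>The map induced by \<open>f\<close> on cosets; for \<open>f\<close> compatible with the two subspaces all the cosets in
  the union coincide, see \<open>quotient_space_map_coset\<close> below.\<close>

definition quotient_space_map :: "('k, 'w, 'm) module_scheme \<Rightarrow> 'w set \<Rightarrow> ('v \<Rightarrow> 'w) \<Rightarrow> 'v set \<Rightarrow> 'w set" where
  "quotient_space_map W N f U = (\<Union>u\<in>U. N +>\<^bsub>W\<^esub> f u)"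

definition tuples :: "(complex, 'v, 'm) module_scheme \<Rightarrow> nat \<Rightarrow> (nat \<Rightarrow> 'v) set" where
  "tuples A n = {1..n} \<rightarrow>\<^sub>E carrier A"

definition multilinear_relations ::
    "(complex, 'v, 'm) module_scheme \<Rightarrow> nat \<Rightarrow> ((nat \<Rightarrow> 'v) \<Rightarrow>\<^sub>0 complex) set" where
  "multilinear_relations A n =
    {Poly_Mapping.single (a(i := x \<oplus>\<^bsub>A\<^esub> y)) 1
       - Poly_Mapping.single (a(i := x)) 1 - Poly_Mapping.single (a(i := y)) 1 | a i x y.
       a \<in> tuples A n \<and> i \<in> {1..n} \<and> x \<in> carrier A \<and> y \<in> carrier A}
    \<union> {Poly_Mapping.single (a(i := c \<odot>\<^bsub>A\<^esub> x)) 1 - Poly_Mapping.single (a(i := x)) c | a i c x.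
       a \<in> tuples A n \<and> i \<in> {1..n} \<and> x \<in> carrier A}"

definition tensor_relations ::
    "(complex, 'v, 'm) module_scheme \<Rightarrow> nat \<Rightarrow> ((nat \<Rightarrow> 'v) \<Rightarrow>\<^sub>0 complex) set" where
  "tensor_relations A n =
    LinearCombinations.module.span class_ring (free_space (tuples A n)) (multilinear_relations A n)"

definition tensor_power ::
    "(complex, 'v, 'm) module_scheme \<Rightarrow> nat \<Rightarrow> (complex, ((nat \<Rightarrow> 'v) \<Rightarrow>\<^sub>0 complex) set) module" where
  "tensor_power A n = quotient_space (free_space (tuples A n)) (tensor_relations A n)"

definition pure_tensor ::
    "(complex, 'v, 'm) module_scheme \<Rightarrow> nat \<Rightarrow> (nat \<Rightarrow> 'v) \<Rightarrow> ((nat \<Rightarrow> 'v) \<Rightarrow>\<^sub>0 complex) set" where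
  "pure_tensor A n a =
    tensor_relations A n +>\<^bsub>free_space (tuples A n)\<^esub> Poly_Mapping.single a 1"

section \<open>Functors on the category of finite sets and surjections\<close>

definition surjections :: "nat \<Rightarrow> nat \<Rightarrow> (nat \<Rightarrow> nat) set" where
  "surjections n m = {\<sigma> \<in> {1..n} \<rightarrow>\<^sub>E {1..m}. \<sigma> ` {1..n} = {1..m}}"

text \<open>The objects of the category are the sets \<open>{1..n}\<close> with \<open>n \<ge> 1\<close>; the values of a functor at
  other arguments are irrelevant.\<close>

record 'v Omega_Vect =
  Ob :: "nat \<Rightarrow> (complex, 'v) module"
  Ar :: "nat \<Rightarrow> nat \<Rightarrow> (nat \<Rightarrow> nat) \<Rightarrow> 'v \<Rightarrow> 'v"

locale Omega_functor =
  fixes F :: "'v Omega_Vect"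
  assumes Ob_vectorspace: "1 \<le> n \<Longrightarrow> vectorspace class_ring (Ob F n)"
    and Ar_linear: "\<lbrakk>1 \<le> n; 1 \<le> m; \<sigma> \<in> surjections n m\<rbrakk>
      \<Longrightarrow> linear_map class_ring (Ob F n) (Ob F m) (Ar F n m \<sigma>)"
    and Ar_id: "\<lbrakk>1 \<le> n; v \<in> carrier (Ob F n)\<rbrakk> \<Longrightarrow> Ar F n n (\<lambda>i\<in>{1..n}. i) v = v"
    and Ar_compose: "\<lbrakk>1 \<le> n; 1 \<le> m; 1 \<le> k; \<sigma> \<in> surjections n m; \<tau> \<in> surjections m k;
        v \<in> carrier (Ob F n)\<rbrakk>
      \<Longrightarrow> Ar F n k (compose {1..n} \<tau> \<sigma>) v = Ar F m k \<tau> (Ar F n m \<sigma> v)"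

definition natural_isomorphism ::
    "'v Omega_Vect \<Rightarrow> 'w Omega_Vect \<Rightarrow> (nat \<Rightarrow> 'v \<Rightarrow> 'w) \<Rightarrow> bool" where
  "natural_isomorphism F G \<phi> \<longleftrightarrow>
    (\<forall>n\<ge>1. linear_map class_ring (Ob F n) (Ob G n) (\<phi> n)
        \<and> bij_betw (\<phi> n) (carrier (Ob F n)) (carrier (Ob G n)))
    \<and> (\<forall>n\<ge>1. \<forall>m\<ge>1. \<forall>\<sigma>\<in>surjections n m. \<forall>v\<in>carrier (Ob F n).
        \<phi> m (Ar F n m \<sigma> v) = Ar G n m \<sigma> (\<phi> n v))"

definition isomorphic_functors :: "'v Omega_Vect \<Rightarrow> 'w Omega_Vect \<Rightarrow> bool" where
  "isomorphic_functors F G \<longleftrightarrow>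
    Omega_functor F \<and> Omega_functor G \<and> (\<exists>\<phi>. natural_isomorphism F G \<phi>)"

section \<open>The Loday functor\<close>

text \<open>The fibres of a surjection are nonempty, so the unit of \<open>A\<close>, from which \<^const>\<open>finprod\<close> starts,
  plays no role in the values; the algebras considered here are unital.\<close>

definition fibre_products ::
    "(complex, 'v, 'm) module_scheme \<Rightarrow> nat \<Rightarrow> nat \<Rightarrow> (nat \<Rightarrow> nat) \<Rightarrow> (nat \<Rightarrow> 'v) \<Rightarrow> (nat \<Rightarrow> 'v)" where
  "fibre_products A n m \<sigma> a = (\<lambda>j\<in>{1..m}. \<Otimes>\<^bsub>A\<^esub>i\<in>{i \<in> {1..n}. \<sigma> i = j}. a i)"

definition Loday ::
    "(complex, 'v, 'm) module_scheme \<Rightarrow> ((nat \<Rightarrow> 'v) \<Rightarrow>\<^sub>0 complex) set Omega_Vect" where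
  "Loday A =
    \<lparr>Ob = tensor_power A,
     Ar = (\<lambda>n m \<sigma>. quotient_space_map (free_space (tuples A m)) (tensor_relations A m)
       (free_space_map (fibre_products A n m \<sigma>)))\<rparr>"

section \<open>Projections and twists\<close>

locale projections_and_twists =
  fixes X :: "'a topology" and Y :: "'b topology"
    and p :: "nat \<Rightarrow> 'a \<Rightarrow> 'a" and q :: "nat \<Rightarrow> 'b \<Rightarrow> 'b"
    and h :: "nat \<Rightarrow> 'a \<Rightarrow> 'b" and h' :: "nat \<Rightarrow> 'b \<Rightarrow> 'a"
  assumes continuous_p: "1 \<le> n \<Longrightarrow> continuous_map X X (p n)"
    and continuous_q: "1 \<le> n \<Longrightarrow> continuous_map Y Y (q n)"
    and continuous_h: "1 \<le> n \<Longrightarrow> continuous_map X Y (h n)"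
    and continuous_h': "1 \<le> n \<Longrightarrow> continuous_map Y X (h' n)"
    and p_idem: "\<lbrakk>1 \<le> n; x \<in> topspace X\<rbrakk> \<Longrightarrow> p n (p n x) = p n x"
    and p_commute: "\<lbrakk>1 \<le> i; 1 \<le> j; x \<in> topspace X\<rbrakk> \<Longrightarrow> p i (p j x) = p j (p i x)"
    and q_idem: "\<lbrakk>1 \<le> n; y \<in> topspace Y\<rbrakk> \<Longrightarrow> q n (q n y) = q n y"
    and q_commute: "\<lbrakk>1 \<le> i; 1 \<le> j; y \<in> topspace Y\<rbrakk> \<Longrightarrow> q i (q j y) = q j (q i y)"
    and Mov_p: "disjoint_family_on (\<lambda>n. {x \<in> topspace X. p n x \<noteq> x}) {1..}"
    and Mov_q: "disjoint_family_on (\<lambda>n. {y \<in> topspace Y. q n y \<noteq> y}) {1..}"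
    and q_h: "\<lbrakk>1 \<le> i; 1 \<le> j; x \<in> topspace X\<rbrakk> \<Longrightarrow> q j (h i x) = h i (p j x)"
    and p_h': "\<lbrakk>1 \<le> i; 1 \<le> j; y \<in> topspace Y\<rbrakk> \<Longrightarrow> p j (h' i y) = h' i (q j y)"
    and h'_h: "\<lbrakk>1 \<le> i; 1 \<le> j; x \<in> topspace X\<rbrakk> \<Longrightarrow> h' j (h i x) = p j (p i x)"
    and h_h': "\<lbrakk>1 \<le> i; 1 \<le> j; y \<in> topspace Y\<rbrakk> \<Longrightarrow> h i (h' j y) = q i (q j y)"

definition connected_by_projections_and_twists :: "'a topology \<Rightarrow> 'b topology \<Rightarrow> bool" where
  "connected_by_projections_and_twists X Y \<longleftrightarrow> (\<exists>p q h h'. projections_and_twists X Y p q h h')"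

section \<open>The Loday functor is a functor\<close>

lemma class_cring: "cring (class_ring :: complex ring)"
proof -
  interpret field "class_ring :: complex ring" by (rule class_field)
  show ?thesis ..
qed

lemma continuous_map_complex_mult: fixes f g :: "'a \<Rightarrow> complex"
  assumes "continuous_map X euclidean f" "continuous_map X euclidean g"
  shows "continuous_map X euclidean (\<lambda>x. f x * g x)"
  using assms by (auto simp: continuous_map_atin intro: tendsto_mult)

lemma continuous_map_restrict_topspace: "continuous_map X euclidean f \<Longrightarrow> continuous_map X euclidean (restrict f (topspace X))"
  by (rule continuous_map_eq) auto

lemma continuous_functions_closed:
  fixes f g :: "'a \<Rightarrow> complex"
  assumes "continuous_map X euclidean f"
  shows "continuous_map X euclidean (\<lambda>x\<in>topspace X. c * f x)" "continuous_map X euclidean (\<lambda>x\<in>topspace X. - f x)"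
    "continuous_map X euclidean g \<Longrightarrow> continuous_map X euclidean (\<lambda>x\<in>topspace X. f x * g x)"
    "continuous_map X euclidean g \<Longrightarrow> continuous_map X euclidean (\<lambda>x\<in>topspace X. f x + g x)"
  using assms by (auto intro!: continuous_map_restrict_topspace continuous_map_complex_mult continuous_map_add continuous_map_minus)

lemma continuous_functions_const: "continuous_map X euclidean (\<lambda>x\<in>topspace X. c::complex)"
  by (auto intro: continuous_map_restrict_topspace)

lemma continuous_functions_algebra: "algebra (class_ring :: complex ring) (continuous_functions X)"
proof (rule algebraI)
  show "cring (class_ring :: complex ring)" by (rule class_cring)
  have ag: "abelian_group (continuous_functions X)"
  proof (rule abelian_groupI)
    fix f assume f: "f \<in> carrier (continuous_functions X)"
    show "\<exists>g\<in>carrier (continuous_functions X). g \<oplus>\<^bsub>continuous_functions X\<^esub> f = \<zero>\<^bsub>continuous_functions X\<^esub>"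
      using f by (intro bexI[of _ "\<lambda>x\<in>topspace X. - f x"])
         (auto simp: continuous_functions_def intro!: continuous_functions_closed)
  qed (auto simp: continuous_functions_def continuous_functions_closed continuous_functions_const extensional_def restrict_def fun_eq_iff algebra_simps continuous_functions_closed[unfolded restrict_def] continuous_functions_const[unfolded restrict_def])
  show "cring (continuous_functions X)"
    by (rule cringI[OF ag comm_monoidI]) 
      (auto simp: continuous_functions_def extensional_def restrict_def fun_eq_iff algebra_simps continuous_functions_closed[unfolded restrict_def] continuous_functions_const[unfolded restrict_def])
qed (auto simp: continuous_functions_def extensional_def restrict_def fun_eq_iff algebra_simps continuous_functions_closed[unfolded restrict_def] continuous_functions_const[unfolded restrict_def])

lemma lookup_map_scale [simp]: "Poly_Mapping.lookup (Poly_Mapping.map ((*) (c::complex)) u) x = c * Poly_Mapping.lookup u x"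
  by (transfer) (auto simp: when_def)

lemma free_space_vectorspace: "vectorspace (class_ring :: complex ring) (free_space S)"
proof (rule vectorspace.intro)
  show "field (class_ring :: complex ring)" by (rule class_field)
  show "module (class_ring :: complex ring) (free_space S)"
  proof (rule module_criteria)
    show "cring (class_ring :: complex ring)" by (rule class_cring)
    show "\<forall>v\<in>carrier (free_space S). \<exists>neg_v\<in>carrier (free_space S). v \<oplus>\<^bsub>free_space S\<^esub> neg_v = \<zero>\<^bsub>free_space S\<^esub>"
      by (intro ballI, rule_tac x="-v" in bexI) (auto simp: free_space_def in_keys_iff subset_iff)
      show "\<forall>v w. v \<in> carrier (free_space S) \<and> w \<in> carrier (free_space S) \<longrightarrow> v \<oplus>\<^bsub>free_space S\<^esub> w \<in> carrier (free_space S)"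
      using keys_add by (fastforce simp: free_space_def)
  qed (auto simp: free_space_def in_keys_iff subset_iff lookup_add algebra_simps intro!: poly_mapping_eqI)
qed

lemma
  assumes V: "vectorspace K V" and N: "submodule K N V"
  shows quotient_space_add: "\<And>x y. \<lbrakk>x \<in> carrier V; y \<in> carrier V\<rbrakk> \<Longrightarrow> (N +>\<^bsub>V\<^esub> x) \<oplus>\<^bsub>quotient_space V N\<^esub> (N +>\<^bsub>V\<^esub> y) = N +>\<^bsub>V\<^esub> (x \<oplus>\<^bsub>V\<^esub> y)"
    and quotient_space_smult: "\<And>c x. \<lbrakk>c \<in> carrier K; x \<in> carrier V\<rbrakk> \<Longrightarrow> c \<odot>\<^bsub>quotient_space V N\<^esub> (N +>\<^bsub>V\<^esub> x) = N +>\<^bsub>V\<^esub> (c \<odot>\<^bsub>V\<^esub> x)"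
    and quotient_space_zero: "\<zero>\<^bsub>quotient_space V N\<^esub> = N +>\<^bsub>V\<^esub> \<zero>\<^bsub>V\<^esub>"
    and quotient_space_carrier: "carrier (quotient_space V N) = (\<lambda>x. N +>\<^bsub>V\<^esub> x) ` carrier V"
    and quotient_space_vs: "vectorspace K (quotient_space V N)"
    and quotient_space_eq: "\<And>x y. \<lbrakk>x \<in> carrier V; y \<in> carrier V\<rbrakk> \<Longrightarrow> y \<in> N +>\<^bsub>V\<^esub> x \<Longrightarrow> N +>\<^bsub>V\<^esub> y = N +>\<^bsub>V\<^esub> x"
    and quotient_space_self: "\<And>x. \<lbrakk>x \<in> carrier V\<rbrakk> \<Longrightarrow> x \<in> N +>\<^bsub>V\<^esub> x"
proof -
  interpret vectorspace K V by fact
  interpret N: submodule K N V by fact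
  interpret NS: additive_subgroup N V
  proof (intro additive_subgroup.intro subgroup.intro)
    fix x assume x: "x \<in> N"
    then have "(\<ominus>\<^bsub>K\<^esub> \<one>\<^bsub>K\<^esub>) \<odot>\<^bsub>V\<^esub> x \<in> N" by (intro N.smult_closed) auto
    moreover have "(\<ominus>\<^bsub>K\<^esub> \<one>\<^bsub>K\<^esub>) \<odot>\<^bsub>V\<^esub> x = \<ominus>\<^bsub>V\<^esub> x" using x N.subset by (intro smult_minus_1) auto
    ultimately show "inv\<^bsub>add_monoid V\<^esub> x \<in> N" by (simp only: a_inv_def)
  qed (use N.subset N.m_closed N.zero_closed in auto)
  interpret NA: abelian_subgroup N V
    by (rule abelian_subgroupI3) (unfold_locales)
  note r = NA.a_rcos_self
  show self: "\<And>x. \<lbrakk>x \<in> carrier V\<rbrakk> \<Longrightarrow> x \<in> N +>\<^bsub>V\<^esub> x" by (rule NA.a_rcos_self)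
  show eq: "\<And>x y. \<lbrakk>x \<in> carrier V; y \<in> carrier V\<rbrakk> \<Longrightarrow> y \<in> N +>\<^bsub>V\<^esub> x \<Longrightarrow> N +>\<^bsub>V\<^esub> y = N +>\<^bsub>V\<^esub> x"
    using NA.a_repr_independence' by metis
  show car: "carrier (quotient_space V N) = (\<lambda>x. N +>\<^bsub>V\<^esub> x) ` carrier V"
    by (auto simp: quotient_space_def A_RCOSETS_def')
  show add: "(N +>\<^bsub>V\<^esub> x) \<oplus>\<^bsub>quotient_space V N\<^esub> (N +>\<^bsub>V\<^esub> y) = N +>\<^bsub>V\<^esub> (x \<oplus>\<^bsub>V\<^esub> y)"
    if "x \<in> carrier V" "y \<in> carrier V" for x y
    using that by (simp add: quotient_space_def NA.a_rcos_sum)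
  show smult: "c \<odot>\<^bsub>quotient_space V N\<^esub> (N +>\<^bsub>V\<^esub> x) = N +>\<^bsub>V\<^esub> (c \<odot>\<^bsub>V\<^esub> x)" if c: "c \<in> carrier K" and x: "x \<in> carrier V" for c x
  proof -
    have *: "v \<oplus>\<^bsub>V\<^esub> (c \<odot>\<^bsub>V\<^esub> (w \<oplus>\<^bsub>V\<^esub> x)) = (v \<oplus>\<^bsub>V\<^esub> c \<odot>\<^bsub>V\<^esub> w) \<oplus>\<^bsub>V\<^esub> c \<odot>\<^bsub>V\<^esub> x" if "v \<in> N" "w \<in> N" for v w
      using that N.subset c x by (auto simp: smult_r_distr a_assoc subset_iff)
    have cl: "v \<oplus>\<^bsub>V\<^esub> c \<odot>\<^bsub>V\<^esub> w \<in> N" if "v \<in> N" "w \<in> N" for v w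
      using that c by auto
    have "N <+>\<^bsub>V\<^esub> ((\<lambda>u. c \<odot>\<^bsub>V\<^esub> u) ` (N +>\<^bsub>V\<^esub> x)) = N +>\<^bsub>V\<^esub> (c \<odot>\<^bsub>V\<^esub> x)"
    proof (intro equalityI subsetI)
      fix z assume "z \<in> N <+>\<^bsub>V\<^esub> ((\<lambda>u. c \<odot>\<^bsub>V\<^esub> u) ` (N +>\<^bsub>V\<^esub> x))"
      then obtain v w where "v \<in> N" "w \<in> N" "z = v \<oplus>\<^bsub>V\<^esub> (c \<odot>\<^bsub>V\<^esub> (w \<oplus>\<^bsub>V\<^esub> x))"
        by (auto simp: set_add_def' a_r_coset_def')
      with * cl show "z \<in> N +>\<^bsub>V\<^esub> (c \<odot>\<^bsub>V\<^esub> x)"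
        by (auto simp: a_r_coset_def')
    next
      fix z assume "z \<in> N +>\<^bsub>V\<^esub> (c \<odot>\<^bsub>V\<^esub> x)"
      then obtain v where "v \<in> N" "z = v \<oplus>\<^bsub>V\<^esub> c \<odot>\<^bsub>V\<^esub> x" by (auto simp: a_r_coset_def')
      then show "z \<in> N <+>\<^bsub>V\<^esub> ((\<lambda>u. c \<odot>\<^bsub>V\<^esub> u) ` (N +>\<^bsub>V\<^esub> x))"
        using self[OF x] by (auto simp: set_add_def')
    qed
    then show ?thesis by (simp add: quotient_space_def)
  qed
  show zero: "\<zero>\<^bsub>quotient_space V N\<^esub> = N +>\<^bsub>V\<^esub> \<zero>\<^bsub>V\<^esub>"
    using N.subset by (simp add: quotient_space_def a_coset_add_zero)
  show "vectorspace K (quotient_space V N)"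
  proof (rule vectorspace.intro)
    show "field K" ..
    show "module K (quotient_space V N)"
    proof (rule module_criteria)
      show "cring K" ..
      show "\<forall>v\<in>carrier (quotient_space V N). \<exists>neg_v\<in>carrier (quotient_space V N). v \<oplus>\<^bsub>quotient_space V N\<^esub> neg_v = \<zero>\<^bsub>quotient_space V N\<^esub>"
        unfolding car ball_simps bex_simps
      proof
        fix x assume "x \<in> carrier V" then show "\<exists>y\<in>carrier V. (N +>\<^bsub>V\<^esub> x) \<oplus>\<^bsub>quotient_space V N\<^esub> (N +>\<^bsub>V\<^esub> y) = \<zero>\<^bsub>quotient_space V N\<^esub>"
          by (intro bexI[of _ "\<ominus>\<^bsub>V\<^esub> x"]) (auto simp: add zero r_neg)
      qed
    qed (auto simp: car add smult zero a_ac smult_l_distr smult_r_distr smult_assoc1 simp del: a_coset_add_zero)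
  qed
qed

lemma quotient_space_map_coset:
  assumes L: "linear_map K V W f" and N: "submodule K N V" and M: "submodule K M W" and f: "f ` N \<subseteq> M"
    and x: "x \<in> carrier V"
  shows "quotient_space_map W M f (N +>\<^bsub>V\<^esub> x) = M +>\<^bsub>W\<^esub> f x"
proof -
  interpret linear_map K V W f by fact
  have V: "vectorspace K V" and W: "vectorspace K W" by unfold_locales
  have *: "M +>\<^bsub>W\<^esub> f (v \<oplus>\<^bsub>V\<^esub> x) = M +>\<^bsub>W\<^esub> f x" if "v \<in> N" for v
  proof (rule quotient_space_eq[OF W M])
    have v: "v \<in> carrier V" using that N by (auto dest: submodule.subset)
    show "f (v \<oplus>\<^bsub>V\<^esub> x) \<in> M +>\<^bsub>W\<^esub> f x" using that f v x by (auto simp: a_r_coset_def')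
    show "f (v \<oplus>\<^bsub>V\<^esub> x) \<in> carrier W" using v x by (auto simp del: T_add)
  qed (use x in auto)
  have "\<exists>v. v \<in> N" using submodule.zero_closed[OF N] by blast
  then show ?thesis using * by (auto simp: quotient_space_map_def a_r_coset_def'[of V N])
qed

lemma quotient_space_map_linear:
  assumes L: "linear_map K V W f" and N: "submodule K N V" and M: "submodule K M W" and f: "f ` N \<subseteq> M"
  shows "linear_map K (quotient_space V N) (quotient_space W M) (quotient_space_map W M f)"
proof -
  interpret linear_map K V W f by fact
  have V: "vectorspace K V" and W: "vectorspace K W" by unfold_locales
  note e = quotient_space_map_coset[OF assms]
  interpret Q: vectorspace K "quotient_space V N" by (rule quotient_space_vs[OF V N])
  interpret R: vectorspace K "quotient_space W M" by (rule quotient_space_vs[OF W M])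
  show ?thesis
    apply unfold_locales
    unfolding module_hom_def quotient_space_carrier[OF V N] quotient_space_carrier[OF W M]
    by (auto simp: e quotient_space_add[OF V N] quotient_space_add[OF W M] quotient_space_smult[OF V N] quotient_space_smult[OF W M])
qed

lemma free_space_map_superset: "finite S \<Longrightarrow> Poly_Mapping.keys u \<subseteq> S \<Longrightarrow>
  free_space_map f u = (\<Sum>a\<in>S. Poly_Mapping.single (f a) (Poly_Mapping.lookup u a))"
  unfolding free_space_map_def by (intro sum.mono_neutral_left) (auto simp: in_keys_iff)

lemma free_space_map_add: "free_space_map f (u + v) = free_space_map f u + free_space_map f v"
  using free_space_map_superset[of "Poly_Mapping.keys u \<union> Poly_Mapping.keys v" u f] free_space_map_superset[of "Poly_Mapping.keys u \<union> Poly_Mapping.keys v" v f]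
    free_space_map_superset[of "Poly_Mapping.keys u \<union> Poly_Mapping.keys v" "u+v" f] keys_add[of u v]
  by (simp add: lookup_add single_add sum.distrib)

lemma map_scale_sum: "Poly_Mapping.map ((*) (c::complex)) (sum g S) = (\<Sum>a\<in>S. Poly_Mapping.map ((*) c) (g a))"
  by (rule poly_mapping_eqI) (simp add: lookup_sum sum_distrib_left)

lemma free_space_map_scale: "free_space_map f (Poly_Mapping.map ((*) c) u) = Poly_Mapping.map ((*) c) (free_space_map f u)"
  by (subst free_space_map_superset[of "Poly_Mapping.keys u"])
    (auto simp: free_space_map_def map_scale_sum in_keys_iff)

lemma free_space_map_single [simp]: "free_space_map f (Poly_Mapping.single a c) = Poly_Mapping.single (f a) c"
  by (subst free_space_map_superset[of "{a}"]) auto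

lemma free_space_map_zero [simp]: "free_space_map f 0 = 0" by (simp add: free_space_map_def)

lemma free_space_map_sum: "free_space_map f (sum g S) = (\<Sum>a\<in>S. free_space_map f (g a))"
  by (induction S rule: infinite_finite_induct) (auto simp: free_space_map_add)
lemma free_space_map_diff: "free_space_map f (u - v) = free_space_map f u - free_space_map f v"
  using free_space_map_add[of f "u - v" v] by simp

lemma free_space_map_comp: "(\<And>a. a \<in> Poly_Mapping.keys u \<Longrightarrow> k a = g (f a)) \<Longrightarrow> free_space_map g (free_space_map f u) = free_space_map k u"
  by (simp add: free_space_map_def[of f] free_space_map_sum) (simp add: free_space_map_def)

lemma free_space_map_id: "(\<And>a. a \<in> Poly_Mapping.keys u \<Longrightarrow> f a = a) \<Longrightarrow> free_space_map f u = u"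
  by (auto simp: free_space_map_def lookup_sum lookup_single when_def in_keys_iff intro!: poly_mapping_eqI)

lemma free_space_map_linear: assumes "f \<in> S \<rightarrow> T"
  shows "linear_map class_ring (free_space S) (free_space T) (free_space_map f)"
proof -
  interpret S: vectorspace class_ring "free_space S" by (rule free_space_vectorspace)
  interpret T: vectorspace class_ring "free_space T" by (rule free_space_vectorspace)
  have "Poly_Mapping.keys (free_space_map f u) \<subseteq> T" if "Poly_Mapping.keys u \<subseteq> S" for u
    unfolding free_space_map_def
    using keys_sum[of "\<lambda>a. Poly_Mapping.single (f a) (Poly_Mapping.lookup u a)" "Poly_Mapping.keys u"] that assms
    by (force split: if_splits)
  then show ?thesis
    apply unfold_locales
    by (auto simp: module_hom_def free_space_def free_space_map_add free_space_map_scale)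
qed

lemma multilinear_relations_subset: assumes A: "algebra class_ring A"
  shows "multilinear_relations A n \<subseteq> carrier (free_space (tuples A n))"
proof -
  interpret A: algebra "class_ring :: complex ring" A by fact
  have upd: "a(i := x) \<in> tuples A n" if "a \<in> tuples A n" "i \<in> {1..n}" "x \<in> carrier A" for a i x
    using that by (auto simp: tuples_def PiE_iff extensional_def)
  have k: "Poly_Mapping.keys (u - v) \<subseteq> S" if "Poly_Mapping.keys u \<subseteq> S" "Poly_Mapping.keys v \<subseteq> S" 
    for u v :: "(nat \<Rightarrow> 'a) \<Rightarrow>\<^sub>0 complex" and S
    using that keys_diff[of u v] by blast
  have sm: "c \<odot>\<^bsub>A\<^esub> x \<in> carrier A" if "x \<in> carrier A" for c x using A.smult_closed[of c x] that by simp
  have sg: "Poly_Mapping.keys (Poly_Mapping.single b c) \<subseteq> tuples A n" if "b \<in> tuples A n" for b and c :: complex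
    using that by auto
  have "Poly_Mapping.keys r \<subseteq> tuples A n" if "r \<in> multilinear_relations A n" for r
    using that unfolding multilinear_relations_def
    by (elim UnE CollectE exE conjE) (simp only:, intro k sg upd A.add.m_closed sm, assumption+)+
  then show ?thesis by (auto simp: free_space_def)
qed

lemma tensor_relations_submodule: assumes A: "algebra class_ring A"
  shows "submodule class_ring (tensor_relations A n) (free_space (tuples A n))"
proof -
  interpret V: vectorspace class_ring "free_space (tuples A n)" by (rule free_space_vectorspace)
  show ?thesis unfolding tensor_relations_def by (rule V.span_is_submodule[OF multilinear_relations_subset[OF A]])
qed

lemma tensor_relations_map:
  assumes A: "algebra class_ring A" and L: "linear_map class_ring (free_space (tuples A n)) (free_space (tuples A m)) f"
    and f: "\<And>r. r \<in> multilinear_relations A n \<Longrightarrow> f r \<in> multilinear_relations A m"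
  shows "f ` tensor_relations A n \<subseteq> tensor_relations A m"
proof -
  interpret linear_map class_ring "free_space (tuples A n)" "free_space (tuples A m)" f by fact
  have T': "module class_ring (free_space (tuples A n))" using free_space_vectorspace by (auto simp: vectorspace_def)
  have T: "module class_ring (free_space (tuples A m))" using free_space_vectorspace by (auto simp: vectorspace_def)
  have sub: "submodule class_ring (tensor_relations A m) (free_space (tuples A m))" by (rule tensor_relations_submodule[OF A])
  define P where "P = {u \<in> carrier (free_space (tuples A n)). f u \<in> tensor_relations A m}"
  have "submodule class_ring P (free_space (tuples A n))"
    by (rule submodule.intro) (auto simp: P_def submodule.module[OF tensor_relations_submodule[OF A]] submodule.m_closed[OF sub] submodule.zero_closed[OF sub] submodule.smult_closed[OF sub])
  moreover have "multilinear_relations A n \<subseteq> P"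
    using f multilinear_relations_subset[OF A, of n] LinearCombinations.module.in_own_span[OF T, OF multilinear_relations_subset[OF A, of m]] by (auto simp: P_def tensor_relations_def)
  ultimately have "tensor_relations A n \<subseteq> P"
    unfolding tensor_relations_def by (intro LinearCombinations.module.span_is_subset[OF T'])
  then show ?thesis by (auto simp: P_def)
qed

lemma fibre_products_tuples: assumes A: "algebra class_ring A"
  shows "fibre_products A n m \<sigma> \<in> tuples A n \<rightarrow> tuples A m"
proof -
  interpret A: algebra "class_ring :: complex ring" A by fact
  show ?thesis unfolding fibre_products_def tuples_def
    by (intro Pi_I restrict_PiE_iff[THEN iffD2] ballI A.finprod_closed) (auto dest: PiE_mem)
qed

lemma fibre_products_upd: assumes A: "algebra class_ring A" and a: "a \<in> tuples A n" and i: "i \<in> {1..n}" and x: "x \<in> carrier A"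
  and s: "\<sigma> i \<in> {1..m}"
  shows "fibre_products A n m \<sigma> (a(i := x)) = (fibre_products A n m \<sigma> a)(\<sigma> i := x \<otimes>\<^bsub>A\<^esub> finprod A a {k \<in> {1..n} - {i}. \<sigma> k = \<sigma> i})"
proof (rule ext)
  interpret A: algebra "class_ring :: complex ring" A by fact
  fix j
  have ac: "a k \<in> carrier A" if "k \<in> {1..n}" for k using a that by (auto simp: tuples_def)
  show "fibre_products A n m \<sigma> (a(i := x)) j = ((fibre_products A n m \<sigma> a)(\<sigma> i := x \<otimes>\<^bsub>A\<^esub> finprod A a {k \<in> {1..n} - {i}. \<sigma> k = \<sigma> i})) j"
  proof (cases "j = \<sigma> i")
    case True
    have e: "{k \<in> {1..n}. \<sigma> k = \<sigma> i} = insert i {k \<in> {1..n} - {i}. \<sigma> k = \<sigma> i}" using i by auto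
    have "finprod A (a(i := x)) {k \<in> {1..n}. \<sigma> k = \<sigma> i} = (a(i:=x)) i \<otimes>\<^bsub>A\<^esub> finprod A (a(i := x)) {k \<in> {1..n} - {i}. \<sigma> k = \<sigma> i}"
      unfolding e using x ac by (intro A.finprod_insert) auto
    also have "finprod A (a(i := x)) {k \<in> {1..n} - {i}. \<sigma> k = \<sigma> i} = finprod A a {k \<in> {1..n} - {i}. \<sigma> k = \<sigma> i}"
      using ac by (intro A.finprod_cong') auto
    finally show ?thesis using True s by (simp add: fibre_products_def)
  next
    case False
    have "finprod A (a(i := x)) {k \<in> {1..n}. \<sigma> k = j} = finprod A a {k \<in> {1..n}. \<sigma> k = j}"
      using ac False by (intro A.finprod_cong') auto
    then show ?thesis using False by (simp add: fibre_products_def del: atLeastAtMost_iff One_nat_def fun_upd_apply) (simp add: fibre_products_def)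
  qed
qed

lemma multilinear_relations_map: assumes A: "algebra class_ring A" and s: "\<sigma> \<in> {1..n} \<rightarrow> {1..m}" and r: "r \<in> multilinear_relations A n"
  shows "free_space_map (fibre_products A n m \<sigma>) r \<in> multilinear_relations A m"
proof -
  interpret A: algebra "class_ring :: complex ring" A by fact
  have ac: "a k \<in> carrier A" if "a \<in> tuples A n" "k \<in> {1..n}" for k a using that by (auto simp: tuples_def)
  have t: "fibre_products A n m \<sigma> a \<in> tuples A m" if "a \<in> tuples A n" for a using fibre_products_tuples[OF A] that by blast
  have sm: "c \<odot>\<^bsub>A\<^esub> x \<in> carrier A" if "x \<in> carrier A" for c x using A.smult_closed[of c x] that by simp
  have fc: "finprod A a {k \<in> {1..n} - {i}. \<sigma> k = \<sigma> i} \<in> carrier A" if "a \<in> tuples A n" for a i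
    using ac[OF that] by (intro A.finprod_closed) auto
  have si: "\<sigma> i \<in> {1..m}" if "i \<in> {1..n}" for i using s that by blast
  note u = fibre_products_upd[OF A, where \<sigma>=\<sigma> and m=m]
  from r consider (add) a i x y where "a \<in> tuples A n" "i \<in> {1..n}" "x \<in> carrier A" "y \<in> carrier A" 
      "r = Poly_Mapping.single (a(i := x \<oplus>\<^bsub>A\<^esub> y)) 1
       - Poly_Mapping.single (a(i := x)) 1 - Poly_Mapping.single (a(i := y)) 1"
    | (scale) a i c x where "a \<in> tuples A n" "i \<in> {1..n}" "x \<in> carrier A" 
      "r = Poly_Mapping.single (a(i := c \<odot>\<^bsub>A\<^esub> x)) 1 - Poly_Mapping.single (a(i := x)) c"
    unfolding multilinear_relations_def by blast
  then show ?thesis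
  proof cases
    case add
    let ?b = "fibre_products A n m \<sigma> a" and ?p = "finprod A a {k \<in> {1..n} - {i}. \<sigma> k = \<sigma> i}"
    have "free_space_map (fibre_products A n m \<sigma>) r = 
      Poly_Mapping.single (?b(\<sigma> i := (x \<otimes>\<^bsub>A\<^esub> ?p) \<oplus>\<^bsub>A\<^esub> (y \<otimes>\<^bsub>A\<^esub> ?p))) 1
       - Poly_Mapping.single (?b(\<sigma> i := x \<otimes>\<^bsub>A\<^esub> ?p)) 1 - Poly_Mapping.single (?b(\<sigma> i := y \<otimes>\<^bsub>A\<^esub> ?p)) 1"
      using add fc[OF add(1)] by (simp add: free_space_map_diff u si A.l_distr del: atLeastAtMost_iff One_nat_def)
    then show ?thesis unfolding multilinear_relations_def
      using t[OF add(1)] si[OF add(2)] A.m_closed[OF add(3) fc[OF add(1), of i]] A.m_closed[OF add(4) fc[OF add(1), of i]] by blast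
  next
    case scale
    let ?b = "fibre_products A n m \<sigma> a" and ?p = "finprod A a {k \<in> {1..n} - {i}. \<sigma> k = \<sigma> i}"
    have "(c \<odot>\<^bsub>A\<^esub> x) \<otimes>\<^bsub>A\<^esub> ?p = c \<odot>\<^bsub>A\<^esub> (x \<otimes>\<^bsub>A\<^esub> ?p)"
      using A.smult_assoc2[of c x ?p] scale fc[OF scale(1)] by simp
    then have "free_space_map (fibre_products A n m \<sigma>) r = 
      Poly_Mapping.single (?b(\<sigma> i := c \<odot>\<^bsub>A\<^esub> (x \<otimes>\<^bsub>A\<^esub> ?p))) 1
       - Poly_Mapping.single (?b(\<sigma> i := x \<otimes>\<^bsub>A\<^esub> ?p)) c"
      using scale by (simp add: free_space_map_diff u si sm del: atLeastAtMost_iff One_nat_def)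
    then show ?thesis unfolding multilinear_relations_def
      using t[OF scale(1)] si[OF scale(2)] A.m_closed[OF scale(3) fc[OF scale(1), of i]] by blast
  qed
qed

lemma fibre_products_id: assumes A: "algebra class_ring A" and a: "a \<in> tuples A n"
  shows "fibre_products A n n (\<lambda>i\<in>{1..n}. i) a = a"
proof -
  interpret A: algebra "class_ring :: complex ring" A by fact
  have *: "{i \<in> {1..n}. (\<lambda>i\<in>{1..n}. i) i = j} = {j}" if "j \<in> {1..n}" for j using that by auto
  show ?thesis
  proof
    fix j show "fibre_products A n n (\<lambda>i\<in>{1..n}. i) a j = a j"
    proof (cases "j \<in> {1..n}")
      case True
      then have "a j \<in> carrier A" using a by (auto simp: tuples_def)
      then have "finprod A a {j} = a j" using A.finprod_insert[of "{}" j a] by simp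
      then show ?thesis using True by (subst fibre_products_def, subst restrict_apply, simp only: *[OF True] if_True)
    next
      case False
      have "a j = undefined" using a False unfolding tuples_def by (rule PiE_arb)
      then show ?thesis using False by (subst fibre_products_def, subst restrict_apply, simp only: if_False)
    qed
  qed
qed

lemma fibre_products_compose: assumes A: "algebra class_ring A" and a: "a \<in> tuples A n"
  and s: "\<sigma> \<in> {1..n} \<rightarrow> {1..m}"
  shows "fibre_products A n k (compose {1..n} \<tau> \<sigma>) a = fibre_products A m k \<tau> (fibre_products A n m \<sigma> a)"
proof -
  interpret A: algebra "class_ring :: complex ring" A by fact
  have ac: "a k \<in> carrier A" if "k \<in> {1..n}" for k using a that by (auto simp: tuples_def)
  have "finprod A a {i \<in> {1..n}. compose {1..n} \<tau> \<sigma> i = j} = 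
     finprod A (fibre_products A n m \<sigma> a) {i \<in> {1..m}. \<tau> i = j}" for j
  proof -
    have "{i \<in> {1..n}. compose {1..n} \<tau> \<sigma> i = j} = (\<Union>l\<in>{l \<in> {1..m}. \<tau> l = j}. {i \<in> {1..n}. \<sigma> i = l})"
      using s by (auto simp: compose_def)
    then have "finprod A a {i \<in> {1..n}. compose {1..n} \<tau> \<sigma> i = j} = 
       finprod A (\<lambda>l. finprod A a {i \<in> {1..n}. \<sigma> i = l}) {l \<in> {1..m}. \<tau> l = j}"
      using ac by (simp only:) (rule A.finprod_UN_disjoint, auto simp: disjnt_def pairwise_def)
    also have "\<dots> = finprod A (fibre_products A n m \<sigma> a) {l \<in> {1..m}. \<tau> l = j}"
      using ac by (intro A.finprod_cong') (auto simp: fibre_products_def intro!: A.finprod_closed)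
    finally show ?thesis .
  qed
  then show ?thesis by (auto simp: fibre_products_def[of A n k] fibre_products_def[of A m k])
qed

lemma Loday_functor: assumes A: "algebra class_ring A"
  shows "Omega_functor (Loday A)"
proof -
  note sub = tensor_relations_submodule[OF A]
  note lin = free_space_map_linear[OF fibre_products_tuples[OF A]]
  have rel: "free_space_map (fibre_products A n m \<sigma>) ` tensor_relations A n \<subseteq> tensor_relations A m"
    if "\<sigma> \<in> surjections n m" for n m \<sigma>
    using that by (intro tensor_relations_map[OF A lin] multilinear_relations_map[OF A]) (auto simp: surjections_def)
  note ev = quotient_space_map_coset[OF lin sub sub rel]
  note ca = quotient_space_carrier[OF free_space_vectorspace sub]
  show ?thesis
  proof (rule Omega_functor.intro)
    fix n show "vectorspace class_ring (Ob (Loday A) n)"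
      by (simp add: Loday_def tensor_power_def quotient_space_vs free_space_vectorspace sub)
    fix m \<sigma> assume s: "\<sigma> \<in> surjections n m"
    show "linear_map class_ring (Ob (Loday A) n) (Ob (Loday A) m) (Ar (Loday A) n m \<sigma>)"
      using quotient_space_map_linear[OF lin sub sub rel[OF s]] by (simp add: Loday_def tensor_power_def)
    fix k \<tau> v assume t: "\<tau> \<in> surjections m k" and v: "v \<in> carrier (Ob (Loday A) n)"
    have c: "compose {1..n} \<tau> \<sigma> \<in> surjections n k"
    proof -
      have "compose {1..n} \<tau> \<sigma> ` {1..n} = \<tau> ` (\<sigma> ` {1..n})" by (auto simp: compose_def image_image)
      moreover have "compose {1..n} \<tau> \<sigma> \<in> {1..n} \<rightarrow>\<^sub>E {1..k}"
      proof (rule PiE_I)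
        fix x assume x: "x \<in> {1..n}"
        have "\<sigma> x \<in> {1..m}" using s x unfolding surjections_def by blast
        then have "\<tau> (\<sigma> x) \<in> {1..k}" using t unfolding surjections_def by blast
        then show "compose {1..n} \<tau> \<sigma> x \<in> {1..k}" using x by (simp add: compose_def)
      qed (auto simp: compose_def)
      ultimately show ?thesis using s t by (simp add: surjections_def)
    qed
    obtain u where u: "u \<in> carrier (free_space (tuples A n))" "v = tensor_relations A n +>\<^bsub>free_space (tuples A n)\<^esub> u"
      using v by (auto simp: Loday_def tensor_power_def ca)
    interpret linear_map class_ring "free_space (tuples A n)" "free_space (tuples A m)" "free_space_map (fibre_products A n m \<sigma>)"
      by (rule lin)
    have "free_space_map (fibre_products A m k \<tau>) (free_space_map (fibre_products A n m \<sigma>) u) = free_space_map (fibre_products A n k (compose {1..n} \<tau> \<sigma>)) u"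
      using u(1) s by (intro free_space_map_comp fibre_products_compose[OF A]) (auto simp: free_space_def surjections_def)
    then show "Ar (Loday A) n k (compose {1..n} \<tau> \<sigma>) v = Ar (Loday A) m k \<tau> (Ar (Loday A) n m \<sigma> v)"
      using u by (simp add: Loday_def ev[OF s] ev[OF t] ev[OF c] del: One_nat_def)
  next
    fix n v assume "v \<in> carrier (Ob (Loday A) n)"
    then obtain u where u: "u \<in> carrier (free_space (tuples A n))" "v = tensor_relations A n +>\<^bsub>free_space (tuples A n)\<^esub> u"
      by (auto simp: Loday_def tensor_power_def ca)
    have i: "(\<lambda>i\<in>{1..n}. i) \<in> surjections n n" by (auto simp: surjections_def)
    have "free_space_map (fibre_products A n n (\<lambda>i\<in>{1..n}. i)) u = u"
      using u(1) by (intro free_space_map_id fibre_products_id[OF A]) (auto simp: free_space_def)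
    then show "Ar (Loday A) n n (\<lambda>i\<in>{1..n}. i) v = v"
      using u by (simp add: Loday_def ev[OF i] del: One_nat_def)
  qed
qed

lemma Loday_pure_tensor: assumes A: "algebra class_ring A" and "\<sigma> \<in> surjections n m" and a: "a \<in> tuples A n"
  shows "Ar (Loday A) n m \<sigma> (pure_tensor A n a) = pure_tensor A m (fibre_products A n m \<sigma> a)"
proof -
  note lin = free_space_map_linear[OF fibre_products_tuples[OF A]]
  have rel: "free_space_map (fibre_products A n m \<sigma>) ` tensor_relations A n \<subseteq> tensor_relations A m"
    using assms by (intro tensor_relations_map[OF A lin] multilinear_relations_map[OF A]) (auto simp: surjections_def)
  have "Poly_Mapping.single a 1 \<in> carrier (free_space (tuples A n))" using a by (simp add: free_space_def)
  then show ?thesis using quotient_space_map_coset[OF lin tensor_relations_submodule[OF A] tensor_relations_submodule[OF A] rel]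
    by (simp add: Loday_def pure_tensor_def)
qed

lemma Loday_continuous_functions: "Omega_functor (Loday (continuous_functions X))"
  by (rule Loday_functor[OF continuous_functions_algebra])

end

theory Submission
  imports Defs
begin

text \<open>A continuous map \<open>f\<close> acts on tensors by an operator \<open>[f]\<close>, pulling back every slot; these operators are
  natural with respect to surjections, and so are their linear combinations. Put
  \<open>E k = (1 - [p 1]) \<cdots> (1 - [p k])\<close>. The isomorphism is \<open>\<phi> = (\<Sum>k. [h' (k + 1)] E k)\<close> and its inverse
  \<open>\<psi>\<close> is the same expression for \<open>q\<close> and \<open>h\<close>. As the \<open>[p k]\<close> are commuting idempotents,
  only the diagonal terms of \<open>\<psi> \<phi>\<close> survive, and they telescope: with \<open>N\<close> summands, \<open>\<psi> \<phi> = 1 - E N\<close>.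
  Finally, disjointness of the sets \<open>Mov (p k)\<close> makes \<open>E k\<close> vanish on the \<open>n\<close>-th tensor power for
  \<open>k > n\<close>, so both sums are finite in each degree.\<close>

section \<open>Families of commuting idempotents\<close>

text \<open>The product of the factors \<open>1 - P j\<close> for \<open>j < k\<close>, that is,
  \<open>E k\<close> in abstract form with the idempotents numbered from 0.\<close>

primrec remainder :: "(nat \<Rightarrow> 'v \<Rightarrow> 'v) \<Rightarrow> nat \<Rightarrow> 'v \<Rightarrow> 'v::ab_group_add" where
  "remainder P 0 u = u"
| "remainder P (Suc k) u = remainder P k u - P k (remainder P k u)"

definition twisted_sum ::
    "(nat \<Rightarrow> 'v \<Rightarrow> 'v::ab_group_add) \<Rightarrow> (nat \<Rightarrow> 'v \<Rightarrow> 'w::ab_group_add) \<Rightarrow> nat \<Rightarrow> 'v \<Rightarrow> 'w" where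
  "twisted_sum P H N u = (\<Sum>k<N. H k (remainder P k u))"

text \<open>The set \<open>C\<close> stands for a subgroup stable under the operators; later it is
  the set of formal sums of admissible tuples, or the set of tensor relations.\<close>

lemma remainder_closed:
  assumes "\<And>u v. u \<in> C \<Longrightarrow> v \<in> C \<Longrightarrow> u - v \<in> C" and "\<And>k u. u \<in> C \<Longrightarrow> P k u \<in> C" and "u \<in> C"
  shows "remainder P k u \<in> C"
  using assms by (induction k) auto

text \<open>\<open>S\<close> can be moved past one factor \<open>1 - P k\<close> at a time. The set
  \<open>C\<close> allows for maps such as fibre products, shown to commute with pullbacks on tuples
  of continuous functions.\<close>

lemma remainder_intertwine:
  assumes "\<And>u v. u \<in> C \<Longrightarrow> v \<in> C \<Longrightarrow> u - v \<in> C" and "\<And>k u. u \<in> C \<Longrightarrow> P k u \<in> C"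
    and "\<And>u v. u \<in> C \<Longrightarrow> v \<in> C \<Longrightarrow> S (u - v) = S u - S v"
    and "\<And>k u. u \<in> C \<Longrightarrow> S (P k u) = Q k (S u)" and "u \<in> C"
  shows "S (remainder P k u) = remainder Q k (S u)"
proof (induction k)
  case (Suc k)
  have "remainder P k u \<in> C" by (rule remainder_closed) (use assms in auto)
  then show ?case using Suc assms by simp
qed simp

lemma additive_remainder:
  assumes "\<And>k. additive (P k)"
  shows "additive (remainder P k)"
proof
  show "remainder P k (u + v) = remainder P k u + remainder P k v" for u v
    by (induction k) (simp_all add: additive.add[OF assms])
qed

lemma additive_twisted_sum:
  assumes "\<And>k. additive (P k)" "\<And>k. additive (H k)"
  shows "additive (twisted_sum P H N)"
  by standard (simp add: twisted_sum_def additive.add[OF additive_remainder] additive.add assms sum.distrib)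

text \<open>These identities hold for operators on formal sums, before any quotient is taken. They
  describe \<open>H'\<close> after \<open>H\<close>; the other composite is reached by exchanging
  the two spaces.\<close>

locale twisted_idempotents =
  fixes P :: "nat \<Rightarrow> 'v::ab_group_add \<Rightarrow> 'v" and Q :: "nat \<Rightarrow> 'w::ab_group_add \<Rightarrow> 'w"
    and H :: "nat \<Rightarrow> 'v \<Rightarrow> 'w" and H' :: "nat \<Rightarrow> 'w \<Rightarrow> 'v"
  assumes additive_P: "additive (P k)" and additive_Q: "additive (Q k)"
    and additive_H: "additive (H k)" and additive_H': "additive (H' k)"
    and P_idem: "P k (P k u) = P k u" and P_commute: "P i (P j u) = P j (P i u)"
    and H_P: "H i (P j u) = Q j (H i u)" and H'_H: "H' i (H j u) = P i (P j u)"
begin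

lemma P_remainder: "P j (remainder P k u) = remainder P k (P j u)"
  by (rule remainder_intertwine[where C = UNIV]) (auto simp: additive.diff[OF additive_P] P_commute)

lemma H_remainder: "H j (remainder P k u) = remainder Q k (H j u)"
  by (rule remainder_intertwine[where C = UNIV]) (auto simp: additive.diff[OF additive_H] H_P)

text \<open>By commutativity \<open>P j\<close> reaches the factor \<open>1 - P j\<close>, which it
  annihilates.\<close>

lemma P_remainder_eq_0: "j < k \<Longrightarrow> P j (remainder P k u) = 0"
proof (induction k)
  case (Suc k)
  then show ?case
    by (cases "j = k") (simp_all add: additive.diff[OF additive_P] P_idem P_commute[of j k] additive.zero[OF additive_P])
qed simp

lemma remainder_id: "(\<And>j. j < k \<Longrightarrow> P j u = 0) \<Longrightarrow> remainder P k u = u"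
  by (induction k) auto

text \<open>The double sum has the terms \<open>P l (P k (remainder P l (remainder P k u)))\<close>.
  If \<open>l < k\<close>, then \<open>P l\<close> kills the inner remainder; if
  \<open>k < l\<close>, then \<open>P k\<close> kills the outer one; the diagonal terms
  telescope.\<close>

lemma twisted_sum_inverse: "twisted_sum Q H' N (twisted_sum P H N u) = u - remainder P N u"
proof -
  note zero = additive.zero[OF additive_P] additive.zero[OF additive_remainder[of P, OF additive_P]]
  have "twisted_sum Q H' N (twisted_sum P H N u) =
      (\<Sum>l<N. \<Sum>k<N. H' l (remainder Q l (H k (remainder P k u))))"
    by (simp add: twisted_sum_def additive.sum[OF additive_remainder[OF additive_Q]] additive.sum[OF additive_H'])
  also have "\<dots> = (\<Sum>l<N. \<Sum>k<N. if l = k then remainder P l u - remainder P (Suc l) u else 0)"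
  proof (intro sum.cong refl)
    fix l k
    \<comment> \<open>Moving \<open>H k\<close> to the left past the remainder turns
      \<open>Q\<close> into \<open>P\<close> and brings \<open>H' l\<close> and \<open>H k\<close>
      together.\<close>
    have *: "H' l (remainder Q l (H k (remainder P k u))) = P l (P k (remainder P l (remainder P k u)))"
      by (simp add: H_remainder[symmetric] H'_H)
    consider "l = k" | "l < k" | "k < l" by linarith
    then show "H' l (remainder Q l (H k (remainder P k u))) =
        (if l = k then remainder P l u - remainder P (Suc l) u else 0)"
    proof cases
      case 1
      \<comment> \<open>The remainder is idempotent: its values are killed by every
        \<open>P j\<close> with \<open>j < k\<close>, so each further factor \<open>1 - P j\<close>
        fixes them.\<close>
      have "remainder P k (remainder P k u) = remainder P k u" by (rule remainder_id[OF P_remainder_eq_0])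
      then show ?thesis using 1 * by (simp add: P_idem)
    next
      case 2
      then have "P l (P k (remainder P l (remainder P k u))) = 0"
        by (simp add: P_commute[of l k]) (simp add: P_remainder[of l l] P_remainder_eq_0 zero)
      then show ?thesis using 2 * by simp
    next
      case 3
      then show ?thesis by (simp add: * P_remainder_eq_0 zero)
    qed
  qed
  also have "\<dots> = (\<Sum>l<N. remainder P l u - remainder P (Suc l) u)" by simp
  also have "\<dots> = u - remainder P N u" by (subst sum_lessThan_telescope') simp
  finally show ?thesis .
qed

end

section \<open>Relations between tensors\<close>

lemma tuples_upd: "a \<in> tuples A n \<Longrightarrow> i \<in> {1..n} \<Longrightarrow> x \<in> carrier A \<Longrightarrow> a(i := x) \<in> tuples A n"
  by (auto simp: tuples_def PiE_iff extensional_def)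

lemma free_space_diff: "u \<in> carrier (free_space S) \<Longrightarrow> v \<in> carrier (free_space S) \<Longrightarrow> u - v \<in> carrier (free_space S)"
  using keys_diff[of u v] by (auto simp: free_space_def)

lemma
  assumes A: "algebra class_ring A"
  shows tensor_relations_add: "u \<in> tensor_relations A n \<Longrightarrow> v \<in> tensor_relations A n \<Longrightarrow> u + v \<in> tensor_relations A n"
    and tensor_relations_diff: "u \<in> tensor_relations A n \<Longrightarrow> v \<in> tensor_relations A n \<Longrightarrow> u - v \<in> tensor_relations A n"
    and tensor_relations_zero: "0 \<in> tensor_relations A n"
    and tensor_relations_scale: "u \<in> tensor_relations A n \<Longrightarrow> Poly_Mapping.map ((*) c) u \<in> tensor_relations A n"
proof -
  interpret N: submodule class_ring "tensor_relations A n" "free_space (tuples A n)"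
    by (rule tensor_relations_submodule[OF A])
  show add: "u + v \<in> tensor_relations A n" if "u \<in> tensor_relations A n" "v \<in> tensor_relations A n" for u v
    using N.m_closed[OF that] by (simp add: free_space_def)
  show scale: "Poly_Mapping.map ((*) c) u \<in> tensor_relations A n" if "u \<in> tensor_relations A n" for c u
    using N.smult_closed[OF _ that, of c] by (simp add: free_space_def)
  show "0 \<in> tensor_relations A n" using N.zero_closed by (simp add: free_space_def)
  have "u - v = u + Poly_Mapping.map ((*) (-1)) v" for u v :: "(nat \<Rightarrow> 'a) \<Rightarrow>\<^sub>0 complex"
    by (rule poly_mapping_eqI) (simp add: lookup_add lookup_minus)
  with add scale show "u - v \<in> tensor_relations A n" if "u \<in> tensor_relations A n" "v \<in> tensor_relations A n"
    using that by metis
qed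

lemma tensor_relations_sum:
  assumes "algebra class_ring A" "\<And>i. i \<in> I \<Longrightarrow> u i \<in> tensor_relations A n"
  shows "(\<Sum>i\<in>I. u i) \<in> tensor_relations A n"
  using assms(2) by (induction I rule: infinite_finite_induct)
    (auto simp: tensor_relations_zero[OF assms(1)] tensor_relations_add[OF assms(1)])

lemma tensor_coset_eqI:
  assumes A: "algebra class_ring A" and u: "u \<in> carrier (free_space (tuples A n))"
    and v: "v \<in> carrier (free_space (tuples A n))" and uv: "u - v \<in> tensor_relations A n"
  shows "tensor_relations A n +>\<^bsub>free_space (tuples A n)\<^esub> u = tensor_relations A n +>\<^bsub>free_space (tuples A n)\<^esub> v"
proof (rule quotient_space_eq[OF free_space_vectorspace tensor_relations_submodule[OF A] v u])
  have "u = (u - v) \<oplus>\<^bsub>free_space (tuples A n)\<^esub> v" by (simp add: free_space_def)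
  then show "u \<in> tensor_relations A n +>\<^bsub>free_space (tuples A n)\<^esub> v"
    using uv by (auto simp: a_r_coset_def')
qed

lemma multilinear_relation_in_tensor_relations:
  assumes A: "algebra class_ring A" and r: "r \<in> multilinear_relations A n"
  shows "r \<in> tensor_relations A n"
  using LinearCombinations.module.in_own_span[OF _ multilinear_relations_subset[OF A]] r
    free_space_vectorspace[of "tuples A n"]
  by (auto simp: tensor_relations_def vectorspace_def)

text \<open>The preimage of the relations is a submodule, so testing generators suffices. Source and
  target may be powers of different algebras, and a generator need only go into the span of the
  relations.\<close>

lemma linear_map_tensor_relations:
  assumes A: "algebra class_ring A" and B: "algebra class_ring B"
    and L: "linear_map class_ring (free_space (tuples A n)) (free_space (tuples B m)) f"
    and f: "\<And>r. r \<in> multilinear_relations A n \<Longrightarrow> f r \<in> tensor_relations B m"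
  shows "f ` tensor_relations A n \<subseteq> tensor_relations B m"
proof -
  interpret linear_map class_ring "free_space (tuples A n)" "free_space (tuples B m)" f by fact
  interpret N: submodule class_ring "tensor_relations B m" "free_space (tuples B m)"
    by (rule tensor_relations_submodule[OF B])
  have T: "module class_ring (free_space (tuples A n))"
    using free_space_vectorspace by (auto simp: vectorspace_def)
  define P where "P = {u \<in> carrier (free_space (tuples A n)). f u \<in> tensor_relations B m}"
  have "submodule class_ring P (free_space (tuples A n))"
    by (rule submodule.intro[OF T]) (auto simp: P_def N.m_closed N.zero_closed N.smult_closed)
  moreover have "multilinear_relations A n \<subseteq> P"
    using f multilinear_relations_subset[OF A] by (auto simp: P_def)
  ultimately have "tensor_relations A n \<subseteq> P"
    unfolding tensor_relations_def by (intro LinearCombinations.module.span_is_subset[OF T])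
  then show ?thesis by (auto simp: P_def)
qed

lemma continuous_functions_minus:
  assumes "f \<in> carrier (continuous_functions X)" "g \<in> carrier (continuous_functions X)"
  shows "(\<lambda>x\<in>topspace X. f x - g x) \<in> carrier (continuous_functions X)"
  using assms by (auto simp: continuous_functions_def intro!: continuous_map_restrict_topspace continuous_map_diff)

text \<open>This is the additivity relation for the decomposition
  \<open>f = (f - g) + g\<close>.\<close>

lemma tensor_relations_slot_diff:
  assumes a: "a \<in> tuples (continuous_functions X) n" and i: "i \<in> {1..n}"
    and f: "f \<in> carrier (continuous_functions X)" and g: "g \<in> carrier (continuous_functions X)"
  shows "Poly_Mapping.single (a(i := f)) 1 - Poly_Mapping.single (a(i := g)) 1
    - Poly_Mapping.single (a(i := \<lambda>x\<in>topspace X. f x - g x)) 1 \<in> tensor_relations (continuous_functions X) n"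
proof (rule multilinear_relation_in_tensor_relations[OF continuous_functions_algebra])
  let ?d = "\<lambda>x\<in>topspace X. f x - g x"
  have d: "?d \<in> carrier (continuous_functions X)"
    by (rule continuous_functions_minus[OF f g])
  have e: "f = ?d \<oplus>\<^bsub>continuous_functions X\<^esub> g"
    using f by (auto simp: continuous_functions_def fun_eq_iff extensional_def)
  have "Poly_Mapping.single (a(i := f)) 1 - Poly_Mapping.single (a(i := g)) 1 - Poly_Mapping.single (a(i := ?d)) 1 =
      Poly_Mapping.single (a(i := ?d \<oplus>\<^bsub>continuous_functions X\<^esub> g)) 1
      - Poly_Mapping.single (a(i := ?d)) 1 - Poly_Mapping.single (a(i := g)) 1"
    by (simp flip: e add: algebra_simps)
  then show "Poly_Mapping.single (a(i := f)) 1 - Poly_Mapping.single (a(i := g)) 1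
      - Poly_Mapping.single (a(i := ?d)) 1 \<in> multilinear_relations (continuous_functions X) n"
    unfolding multilinear_relations_def using a i d g by blast
qed

text \<open>In the homogeneity relation with scalar 0 the second term has coefficient 0 and
  disappears, so the pure tensor itself is a generator.\<close>

lemma tensor_relations_zero_slot:
  assumes a: "a \<in> tuples (continuous_functions X) n" and i: "i \<in> {1..n}"
    and ai: "a i = (\<lambda>x\<in>topspace X. 0)"
  shows "Poly_Mapping.single a (1::complex) \<in> tensor_relations (continuous_functions X) n"
proof (rule multilinear_relation_in_tensor_relations[OF continuous_functions_algebra])
  let ?z = "\<lambda>x\<in>topspace X. 0 :: complex"
  have z: "?z \<in> carrier (continuous_functions X)"
    by (auto simp: continuous_functions_def intro: continuous_map_restrict_topspace)
  have "0 \<odot>\<^bsub>continuous_functions X\<^esub> ?z = ?z" by (auto simp: continuous_functions_def)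
  then have "Poly_Mapping.single a 1 =
      Poly_Mapping.single (a(i := 0 \<odot>\<^bsub>continuous_functions X\<^esub> ?z)) 1 - Poly_Mapping.single (a(i := ?z)) (0::complex)"
    using ai by simp (metis fun_upd_triv)
  then show "Poly_Mapping.single a (1::complex) \<in> multilinear_relations (continuous_functions X) n"
    unfolding multilinear_relations_def using a i z by blast
qed

section \<open>Pulling back tensors\<close>

text \<open>The two restrictions keep the tuple and its entries extensional, so that identities
  between composed maps become equalities of tuples.\<close>

definition pullback :: "'a topology \<Rightarrow> ('a \<Rightarrow> 'b) \<Rightarrow> nat \<Rightarrow> (nat \<Rightarrow> 'b \<Rightarrow> complex) \<Rightarrow> nat \<Rightarrow> 'a \<Rightarrow> complex" where
  "pullback X f n a = (\<lambda>i\<in>{1..n}. \<lambda>x\<in>topspace X. a i (f x))"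

abbreviation pullback_tensor ::
    "'a topology \<Rightarrow> ('a \<Rightarrow> 'b) \<Rightarrow> nat \<Rightarrow> ((nat \<Rightarrow> 'b \<Rightarrow> complex) \<Rightarrow>\<^sub>0 complex) \<Rightarrow> ((nat \<Rightarrow> 'a \<Rightarrow> complex) \<Rightarrow>\<^sub>0 complex)" where
  "pullback_tensor X f n \<equiv> free_space_map (pullback X f n)"

lemma additive_free_space_map: "additive (free_space_map f)"
  by standard (rule free_space_map_add)

text \<open>Pulling back is contravariant. The equality holds for arbitrary formal sums, not just
  modulo relations, so the operators can satisfy the identities of
  \<open>twisted_idempotents\<close> on the whole type.\<close>

lemma pullback_tensor_comp:
  assumes "f ` topspace X \<subseteq> topspace Y" and "\<And>x. x \<in> topspace X \<Longrightarrow> g (f x) = k x"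
  shows "pullback_tensor X f n (pullback_tensor Y g n u) = pullback_tensor X k n u"
  using assms by (intro free_space_map_comp) (auto simp: pullback_def fun_eq_iff restrict_def)

lemma pullback_tensor_comp_cong:
  assumes "f ` topspace X \<subseteq> topspace Y" "f' ` topspace X \<subseteq> topspace Z"
    and "\<And>x. x \<in> topspace X \<Longrightarrow> g (f x) = g' (f' x)"
  shows "pullback_tensor X f n (pullback_tensor Y g n u) = pullback_tensor X f' n (pullback_tensor Z g' n u)"
proof -
  have "pullback_tensor X f n (pullback_tensor Y g n u) = pullback_tensor X (\<lambda>x. g (f x)) n u"
    by (rule pullback_tensor_comp) (use assms in auto)
  also have "\<dots> = pullback_tensor X f' n (pullback_tensor Z g' n u)"
    by (rule pullback_tensor_comp[symmetric]) (use assms in auto)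
  finally show ?thesis .
qed

lemma comp_in_continuous_functions:
  assumes "continuous_map X Y f" "a \<in> carrier (continuous_functions Y)"
  shows "(\<lambda>x\<in>topspace X. a (f x)) \<in> carrier (continuous_functions X)"
  using assms continuous_map_compose[OF assms(1), of euclidean a]
  by (auto simp: continuous_functions_def o_def intro: continuous_map_restrict_topspace)

lemma pullback_tuples:
  assumes "continuous_map X Y f"
  shows "pullback X f n \<in> tuples (continuous_functions Y) n \<rightarrow> tuples (continuous_functions X) n"
  using comp_in_continuous_functions[OF assms] unfolding pullback_def tuples_def by (force intro!: restrict_PiE_iff[THEN iffD2])

lemma pullback_upd:
  "i \<in> {1..n} \<Longrightarrow> pullback X f n (a(i := b)) = (pullback X f n a)(i := \<lambda>x\<in>topspace X. b (f x))"
  by (auto simp: pullback_def fun_eq_iff restrict_def)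

lemma pullback_tensor_carrier:
  assumes "continuous_map X Y f" "u \<in> carrier (free_space (tuples (continuous_functions Y) n))"
  shows "pullback_tensor X f n u \<in> carrier (free_space (tuples (continuous_functions X) n))"
  by (rule linear_map.T_im[OF free_space_map_linear[OF pullback_tuples[OF assms(1)]] assms(2)])

text \<open>Composition with \<open>f\<close> is linear in each slot, so it sends generating
  relations to generating relations.\<close>

lemma pullback_tensor_relations:
  assumes f: "continuous_map X Y f" and u: "u \<in> tensor_relations (continuous_functions Y) n"
  shows "pullback_tensor X f n u \<in> tensor_relations (continuous_functions X) n"
proof -
  let ?A = "continuous_functions X" and ?B = "continuous_functions Y"
  note A = continuous_functions_algebra
  have t: "pullback X f n a \<in> tuples ?A n" if "a \<in> tuples ?B n" for a
    using pullback_tuples[OF f] that by blast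
  have ff: "f x \<in> topspace Y" if "x \<in> topspace X" for x using f that by (auto simp: continuous_map_def)
  have "pullback_tensor X f n r \<in> multilinear_relations ?A n" if r: "r \<in> multilinear_relations ?B n" for r
  proof -
    from r consider (add) a i x y where "a \<in> tuples ?B n" "i \<in> {1..n}" "x \<in> carrier ?B" "y \<in> carrier ?B"
        "r = Poly_Mapping.single (a(i := x \<oplus>\<^bsub>?B\<^esub> y)) 1
         - Poly_Mapping.single (a(i := x)) 1 - Poly_Mapping.single (a(i := y)) 1"
      | (scale) a i c x where "a \<in> tuples ?B n" "i \<in> {1..n}" "x \<in> carrier ?B"
        "r = Poly_Mapping.single (a(i := c \<odot>\<^bsub>?B\<^esub> x)) 1 - Poly_Mapping.single (a(i := x)) c"
      unfolding multilinear_relations_def by blast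
    then show ?thesis
    proof cases
      case add
      let ?a = "pullback X f n a" and ?x = "\<lambda>z\<in>topspace X. x (f z)" and ?y = "\<lambda>z\<in>topspace X. y (f z)"
      have "(\<lambda>z\<in>topspace X. (x \<oplus>\<^bsub>?B\<^esub> y) (f z)) = ?x \<oplus>\<^bsub>?A\<^esub> ?y"
        using ff by (auto simp: continuous_functions_def)
      then have "pullback_tensor X f n r = Poly_Mapping.single (?a(i := ?x \<oplus>\<^bsub>?A\<^esub> ?y)) 1
         - Poly_Mapping.single (?a(i := ?x)) 1 - Poly_Mapping.single (?a(i := ?y)) 1"
        using add(2,5) by (simp only: free_space_map_diff free_space_map_single pullback_upd)
      then show ?thesis unfolding multilinear_relations_def
        using t[OF add(1)] add(2) comp_in_continuous_functions[OF f add(3)] comp_in_continuous_functions[OF f add(4)] by blast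
    next
      case scale
      let ?a = "pullback X f n a" and ?x = "\<lambda>z\<in>topspace X. x (f z)"
      have "(\<lambda>z\<in>topspace X. (c \<odot>\<^bsub>?B\<^esub> x) (f z)) = c \<odot>\<^bsub>?A\<^esub> ?x"
        using ff by (auto simp: continuous_functions_def)
      then have "pullback_tensor X f n r = Poly_Mapping.single (?a(i := c \<odot>\<^bsub>?A\<^esub> ?x)) 1
         - Poly_Mapping.single (?a(i := ?x)) c"
        using scale(2,4) by (simp only: free_space_map_diff free_space_map_single pullback_upd)
      then show ?thesis unfolding multilinear_relations_def
        using t[OF scale(1)] scale(2) comp_in_continuous_functions[OF f scale(3)] by blast
    qed
  qed
  then have "pullback_tensor X f n ` tensor_relations ?B n \<subseteq> tensor_relations ?A n"
    by (intro linear_map_tensor_relations A free_space_map_linear pullback_tuples[OF f])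
      (auto intro: multilinear_relation_in_tensor_relations[OF A])
  then show ?thesis using u by blast
qed

section \<open>Compatibility of pullbacks with fibre products\<close>

lemma finprod_continuous_functions:
  assumes "finite S" "\<And>i. i \<in> S \<Longrightarrow> a i \<in> carrier (continuous_functions X)"
  shows "finprod (continuous_functions X) a S = (\<lambda>x\<in>topspace X. \<Prod>i\<in>S. a i x)"
  using assms
proof (induction S)
  interpret algebra "class_ring :: complex ring" "continuous_functions X" by (rule continuous_functions_algebra)
  {
    case empty
    have "finprod (continuous_functions X) a {} = \<one>\<^bsub>continuous_functions X\<^esub>" by simp
    also have "\<dots> = (\<lambda>x\<in>topspace X. \<Prod>i\<in>{}. a i x)" by (simp add: continuous_functions_def)
    finally show ?case .
  next
    case (insert i S)
    then have "finprod (continuous_functions X) a (insert i S) = a i \<otimes>\<^bsub>continuous_functions X\<^esub> finprod (continuous_functions X) a S"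
      by (intro finprod_insert) auto
    with insert show ?case by (auto simp: continuous_functions_def)
  }
qed

text \<open>Products of functions are formed pointwise, so composing with \<open>f\<close> before or
  after multiplying gives the same function. This is the naturality of \<open>[f]\<close>.\<close>

lemma fibre_products_pullback:
  assumes f: "continuous_map X Y f" and a: "a \<in> tuples (continuous_functions Y) n"
  shows "fibre_products (continuous_functions X) n m \<sigma> (pullback X f n a) =
    pullback X f m (fibre_products (continuous_functions Y) n m \<sigma> a)"
proof -
  have ac: "a i \<in> carrier (continuous_functions Y)" if "i \<in> {1..n}" for i
    using a that by (auto simp: tuples_def)
  have pc: "pullback X f n a i \<in> carrier (continuous_functions X)" if "i \<in> {1..n}" for i
    using comp_in_continuous_functions[OF f ac[OF that]] that by (simp add: pullback_def)
  have ff: "f x \<in> topspace Y" if "x \<in> topspace X" for x using f that by (auto simp: continuous_map_def)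
  have "finprod (continuous_functions X) (pullback X f n a) {i \<in> {1..n}. \<sigma> i = j} =
      (\<lambda>x\<in>topspace X. finprod (continuous_functions Y) a {i \<in> {1..n}. \<sigma> i = j} (f x))" for j
  proof -
    have "finprod (continuous_functions X) (pullback X f n a) {i \<in> {1..n}. \<sigma> i = j} =
        (\<lambda>x\<in>topspace X. \<Prod>i\<in>{i \<in> {1..n}. \<sigma> i = j}. pullback X f n a i x)"
      using pc by (intro finprod_continuous_functions) auto
    also have "\<dots> = (\<lambda>x\<in>topspace X. \<Prod>i\<in>{i \<in> {1..n}. \<sigma> i = j}. a i (f x))"
      by (intro restrict_ext prod.cong) (auto simp: pullback_def)
    also have "\<dots> = (\<lambda>x\<in>topspace X. finprod (continuous_functions Y) a {i \<in> {1..n}. \<sigma> i = j} (f x))"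
      using ac ff by (intro restrict_ext) (subst finprod_continuous_functions, auto)
    finally show ?thesis .
  qed
  then show ?thesis
    by (simp add: fibre_products_def pullback_def[of X f m] cong: restrict_cong del: atLeastAtMost_iff One_nat_def)
qed

lemma fibre_products_pullback_tensor:
  assumes f: "continuous_map X Y f" and u: "u \<in> carrier (free_space (tuples (continuous_functions Y) n))"
  shows "free_space_map (fibre_products (continuous_functions X) n m \<sigma>) (pullback_tensor X f n u) =
    pullback_tensor X f m (free_space_map (fibre_products (continuous_functions Y) n m \<sigma>) u)"
proof -
  have "free_space_map (fibre_products (continuous_functions X) n m \<sigma>) (pullback_tensor X f n u) =
      free_space_map (\<lambda>a. pullback X f m (fibre_products (continuous_functions Y) n m \<sigma> a)) u"
    using u fibre_products_pullback[OF f] by (intro free_space_map_comp) (auto simp: free_space_def)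
  also have "\<dots> = pullback_tensor X f m (free_space_map (fibre_products (continuous_functions Y) n m \<sigma>) u)"
    by (rule free_space_map_comp[symmetric]) simp
  finally show ?thesis .
qed

lemma Ob_Loday: "Ob (Loday A) = tensor_power A"
  by (simp add: Loday_def)

lemma Loday_coset:
  assumes A: "algebra class_ring A" and \<sigma>: "\<sigma> \<in> surjections n m" and u: "u \<in> carrier (free_space (tuples A n))"
  shows "Ar (Loday A) n m \<sigma> (tensor_relations A n +>\<^bsub>free_space (tuples A n)\<^esub> u) =
    tensor_relations A m +>\<^bsub>free_space (tuples A m)\<^esub> free_space_map (fibre_products A n m \<sigma>) u"
proof -
  note lin = free_space_map_linear[OF fibre_products_tuples[OF A]]
  have "free_space_map (fibre_products A n m \<sigma>) ` tensor_relations A n \<subseteq> tensor_relations A m"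
    using \<sigma> by (intro tensor_relations_map[OF A lin] multilinear_relations_map[OF A]) (auto simp: surjections_def)
  from quotient_space_map_coset[OF lin tensor_relations_submodule[OF A] tensor_relations_submodule[OF A] this u]
  show ?thesis by (simp add: Loday_def)
qed

section \<open>The natural isomorphism\<close>

lemma map_scale_diff: "Poly_Mapping.map ((*) (c::complex)) (u - v) = Poly_Mapping.map ((*) c) u - Poly_Mapping.map ((*) c) v"
  by (rule poly_mapping_eqI) (simp add: lookup_minus algebra_simps)

context projections_and_twists
begin

text \<open>The axioms are symmetric in the two spaces, so every result below also holds for the
  candidate inverse.\<close>

lemma swap: "projections_and_twists Y X q p h' h"
  by (rule projections_and_twists.intro)
    (simp_all only: continuous_p continuous_q continuous_h continuous_h' p_idem q_idem
      p_commute q_commute Mov_p Mov_q q_h p_h' h'_h h_h')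

text \<open>The abstract families start at 0 and the maps \<open>p\<close> at 1, hence the shift by
  \<open>Suc\<close>.\<close>

abbreviation proj :: "nat \<Rightarrow> nat \<Rightarrow> ((nat \<Rightarrow> 'a \<Rightarrow> complex) \<Rightarrow>\<^sub>0 complex) \<Rightarrow> ((nat \<Rightarrow> 'a \<Rightarrow> complex) \<Rightarrow>\<^sub>0 complex)" where
  "proj n k \<equiv> pullback_tensor X (p (Suc k)) n"

text \<open>Pulling back reverses arrows: the map \<open>h'\<close> from \<open>Y\<close> to
  \<open>X\<close> carries tensors of functions on \<open>X\<close> to tensors of functions on
  \<open>Y\<close>.\<close>

abbreviation twist :: "nat \<Rightarrow> nat \<Rightarrow> ((nat \<Rightarrow> 'a \<Rightarrow> complex) \<Rightarrow>\<^sub>0 complex) \<Rightarrow> ((nat \<Rightarrow> 'b \<Rightarrow> complex) \<Rightarrow>\<^sub>0 complex)" where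
  "twist n k \<equiv> pullback_tensor Y (h' (Suc k)) n"

abbreviation tensors :: "nat \<Rightarrow> ((nat \<Rightarrow> 'a \<Rightarrow> complex) \<Rightarrow>\<^sub>0 complex) set" where
  "tensors n \<equiv> carrier (free_space (tuples (continuous_functions X) n))"

abbreviation relations :: "nat \<Rightarrow> ((nat \<Rightarrow> 'a \<Rightarrow> complex) \<Rightarrow>\<^sub>0 complex) set" where
  "relations n \<equiv> tensor_relations (continuous_functions X) n"

abbreviation tensors' :: "nat \<Rightarrow> ((nat \<Rightarrow> 'b \<Rightarrow> complex) \<Rightarrow>\<^sub>0 complex) set" where
  "tensors' n \<equiv> carrier (free_space (tuples (continuous_functions Y) n))"

abbreviation relations' :: "nat \<Rightarrow> ((nat \<Rightarrow> 'b \<Rightarrow> complex) \<Rightarrow>\<^sub>0 complex) set" where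
  "relations' n \<equiv> tensor_relations (continuous_functions Y) n"

lemma continuous_p_Suc: "continuous_map X X (p (Suc k))"
  by (rule continuous_p) simp

lemma continuous_h'_Suc: "continuous_map Y X (h' (Suc k))"
  by (rule continuous_h') simp

lemma
  shows p_topspace: "1 \<le> n \<Longrightarrow> x \<in> topspace X \<Longrightarrow> p n x \<in> topspace X"
    and q_topspace: "1 \<le> n \<Longrightarrow> y \<in> topspace Y \<Longrightarrow> q n y \<in> topspace Y"
    and h_topspace: "1 \<le> n \<Longrightarrow> x \<in> topspace X \<Longrightarrow> h n x \<in> topspace Y"
    and h'_topspace: "1 \<le> n \<Longrightarrow> y \<in> topspace Y \<Longrightarrow> h' n y \<in> topspace X"
  using continuous_p continuous_q continuous_h continuous_h' by (auto simp: continuous_map_def Pi_iff)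

text \<open>Each identity is one of the axioms on points, read contravariantly: \<open>p_h'\<close>
  yields the intertwining of \<open>twist\<close> with the projections, and \<open>h'_h\<close> the
  composite of the two twists.\<close>

lemma twisted_idempotents:
  "twisted_idempotents (proj n) (\<lambda>k. pullback_tensor Y (q (Suc k)) n) (twist n) (\<lambda>k. pullback_tensor X (h (Suc k)) n)"
proof
  fix i j k u w
  show "proj n k (proj n k u) = proj n k u"
    by (rule pullback_tensor_comp) (auto simp: p_idem p_topspace)
  show "proj n i (proj n j u) = proj n j (proj n i u)"
    by (rule pullback_tensor_comp_cong) (auto simp: p_topspace intro: p_commute)
  show "twist n i (proj n j u) = pullback_tensor Y (q (Suc j)) n (twist n i u)"
    by (rule pullback_tensor_comp_cong) (auto simp: q_topspace h'_topspace p_h')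
  show "pullback_tensor X (h (Suc i)) n (twist n j u) = proj n i (proj n j u)"
    by (rule pullback_tensor_comp_cong) (auto simp: p_topspace h_topspace h'_h)
qed (simp_all add: free_space_map_add)

section \<open>Remainders on tensor powers and their vanishing\<close>

lemma proj_remainder_swap: "proj n j (remainder (proj n) k u) = remainder (proj n) k (proj n j u)"
  by (rule twisted_idempotents.P_remainder[OF twisted_idempotents])

lemma remainder_diff: "remainder (proj n) k (u - v) = remainder (proj n) k u - remainder (proj n) k v"
  by (rule additive.diff[OF additive_remainder]) (rule additive_free_space_map)

lemma remainder_sum: "remainder (proj n) k (\<Sum>i\<in>I. u i) = (\<Sum>i\<in>I. remainder (proj n) k (u i))"
  by (rule additive.sum[OF additive_remainder]) (rule additive_free_space_map)

lemma remainder_tensors: "u \<in> tensors n \<Longrightarrow> remainder (proj n) k u \<in> tensors n"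
  by (rule remainder_closed) (auto intro: free_space_diff pullback_tensor_carrier continuous_p_Suc)

lemma remainder_relations: "u \<in> relations n \<Longrightarrow> remainder (proj n) k u \<in> relations n"
  by (rule remainder_closed)
    (auto intro: tensor_relations_diff continuous_functions_algebra pullback_tensor_relations continuous_p_Suc)

lemma remainder_scale:
  "remainder (proj n) k (Poly_Mapping.map ((*) c) u) = Poly_Mapping.map ((*) c) (remainder (proj n) k u)"
  by (rule remainder_intertwine[where C = UNIV, symmetric]) (auto simp: map_scale_diff free_space_map_scale)

text \<open>At every point one of \<open>p i\<close> and \<open>p k\<close> acts trivially.\<close>

lemma p_diff_invariant:
  fixes f :: "'a \<Rightarrow> complex"
  assumes "1 \<le> i" "1 \<le> k" "i \<noteq> k" "x \<in> topspace X"
  shows "f (p i x) - f (p k (p i x)) = f x - f (p k x)"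
proof -
  have "{x \<in> topspace X. p i x \<noteq> x} \<inter> {x \<in> topspace X. p k x \<noteq> x} = {}"
    using disjoint_family_onD[OF Mov_p, of i k] assms(1-3) by simp
  then consider "p i x = x" | "p k x = x" using assms(4) by blast
  then show ?thesis
  proof cases
    case 2
    \<comment> \<open>By commutativity \<open>p k\<close> fixes \<open>p i x\<close> as well, so
      both differences are 0.\<close>
    then have "p k (p i x) = p i x" using p_commute[of k i x] assms by simp
    then show ?thesis using 2 by simp
  qed simp
qed

text \<open>Each factor \<open>1 - proj n i\<close> turns a pure tensor, by telescoping over the slots, into a sum of pure
  tensors with one more slot fixed by the remaining projections; once all slots are fixed,
  the next factor vanishes.\<close>

lemma remainder_fixed_slots:
  assumes "a \<in> tuples (continuous_functions X) n" and "M \<subseteq> {1..n}"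
    and "\<And>i j x. j \<in> M \<Longrightarrow> i < k \<Longrightarrow> x \<in> topspace X \<Longrightarrow> a j (p (Suc i) x) = a j x"
    and "card ({1..n} - M) < k"
  shows "remainder (proj n) k (Poly_Mapping.single a 1) \<in> relations n"
  using assms
\<comment> \<open>The step applies the factor \<open>1 - proj n k\<close> to the pure tensor first,
  which changes \<open>a\<close> and \<open>M\<close>. The case \<open>k = 0\<close> is void because
  no cardinality is below 0.\<close>
proof (induction k arbitrary: a M)
  case (Suc k)
  let ?pk = "p (Suc k)"
  \<comment> \<open>The tuples \<open>c j\<close> interpolate between \<open>a\<close> and its
    pullback: the first \<open>j\<close> slots are already pulled back.\<close>
  define c where "c j = (\<lambda>i\<in>{1..n}. if i \<le> j then \<lambda>x\<in>topspace X. a i (?pk x) else a i)" for j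
  have a: "a i \<in> carrier (continuous_functions X)" if "i \<in> {1..n}" for i
    using Suc.prems(1) that by (auto simp: tuples_def)
  have pa: "(\<lambda>x\<in>topspace X. a i (?pk x)) \<in> carrier (continuous_functions X)" if "i \<in> {1..n}" for i
    using comp_in_continuous_functions[OF continuous_p_Suc a[OF that]] .
  have c: "c j \<in> tuples (continuous_functions X) n" for j
    using a pa by (auto simp: c_def tuples_def)
  have "c 0 = a" using Suc.prems(1) by (auto simp: c_def tuples_def PiE_iff extensional_def fun_eq_iff)
  moreover have "c n = pullback X ?pk n a" by (auto simp: c_def pullback_def fun_eq_iff)
  ultimately have tele: "Poly_Mapping.single a 1 - proj n k (Poly_Mapping.single a 1) =
      (\<Sum>j<n. Poly_Mapping.single (c j) 1 - Poly_Mapping.single (c (Suc j)) (1::complex))"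
    by (subst sum_lessThan_telescope') simp
  have "remainder (proj n) k (Poly_Mapping.single (c j) 1 - Poly_Mapping.single (c (Suc j)) 1) \<in> relations n"
    if j: "j < n" for j
  proof -
    let ?i = "Suc j"
    \<comment> \<open>Consecutive tuples differ only in slot \<open>Suc j\<close>; modulo relations
      their difference is the single pure tensor \<open>b\<close> with the difference of the two
      entries in that slot.\<close>
    define b where "b = (c j)(?i := \<lambda>x\<in>topspace X. a ?i x - (\<lambda>x\<in>topspace X. a ?i (?pk x)) x)"
    have i: "?i \<in> {1..n}" using j by auto
    have "c j = (c j)(?i := a ?i)" "c (Suc j) = (c j)(?i := \<lambda>x\<in>topspace X. a ?i (?pk x))"
      using i by (auto simp: c_def fun_eq_iff)
    then have "Poly_Mapping.single (c j) 1 - Poly_Mapping.single (c (Suc j)) 1 - Poly_Mapping.single b 1 \<in> relations n"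
      using tensor_relations_slot_diff[OF c i a[OF i] pa[OF i], of j] by (simp only: b_def)
    then have r: "remainder (proj n) k (Poly_Mapping.single (c j) 1 - Poly_Mapping.single (c (Suc j)) 1)
        - remainder (proj n) k (Poly_Mapping.single b 1) \<in> relations n"
      unfolding remainder_diff[symmetric] by (rule remainder_relations)
    have b: "b \<in> tuples (continuous_functions X) n"
      unfolding b_def by (rule tuples_upd[OF c i continuous_functions_minus[OF a[OF i] pa[OF i]]])
    have bi: "b ?i = (\<lambda>x\<in>topspace X. a ?i x - a ?i (?pk x))"
      by (auto simp: b_def)
    have "remainder (proj n) k (Poly_Mapping.single b 1) \<in> relations n"
    proof (cases "?i \<in> M")
      case True
      \<comment> \<open>A slot in \<open>M\<close> is already invariant under
        \<open>p (Suc k)\<close>, so the difference entry is 0.\<close>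
      then have "b ?i = (\<lambda>x\<in>topspace X. 0)"
        unfolding bi using Suc.prems(3)[OF True lessI] by (intro restrict_ext) simp
      then show ?thesis by (intro remainder_relations tensor_relations_zero_slot[OF b i])
    next
      case False
      show ?thesis
      \<comment> \<open>The new entry is invariant under the remaining projections, so slot
        \<open>Suc j\<close> joins \<open>M\<close>: one factor is spent and one free slot is gained
        for \<open>M\<close>.\<close>
      proof (rule Suc.IH[OF b, where M = "insert ?i M"])
        show "insert ?i M \<subseteq> {1..n}" using i Suc.prems(2) by auto
        have "?i \<in> {1..n} - M" using i False by (rule DiffI)
        then have "card ({1..n} - M - {?i}) < card ({1..n} - M)" by (intro card_Diff1_less) simp
        also have "{1..n} - M - {?i} = {1..n} - insert ?i M" by (rule Diff_insert[symmetric])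
        finally show "card ({1..n} - insert ?i M) < k" using Suc.prems(4) by simp
        fix i' l x assume l: "l \<in> insert ?i M" and i': "i' < k" and x: "x \<in> topspace X"
        show "b l (p (Suc i') x) = b l x"
        proof (cases "l = ?i")
          case True
          have "a ?i (p (Suc i') x) - a ?i (?pk (p (Suc i') x)) = a ?i x - a ?i (?pk x)"
            by (rule p_diff_invariant[of "Suc i'" "Suc k" x "a ?i"]) (use i' x in simp_all)
          then show ?thesis unfolding True bi using x p_topspace[of "Suc i'" x] by simp
        next
          case False
          then have lM: "l \<in> M" using l by simp
          then have lN: "l \<in> {1..n}" using Suc.prems(2) by blast
          have eq: "b l y = a l y" if "y \<in> topspace X" for y
          proof -
            have "b l y = c j l y" using False by (simp add: b_def)
            \<comment> \<open>Slots in \<open>M\<close> are not changed by \<open>p (Suc k)\<close>,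
              so it does not matter whether \<open>c j\<close> has pulled back slot
              \<open>l\<close>.\<close>
            also have "\<dots> = a l y" using lN that Suc.prems(3)[OF lM lessI that] by (simp add: c_def)
            finally show ?thesis .
          qed
          have "a l (p (Suc i') x) = a l x" by (rule Suc.prems(3)[OF lM _ x]) (use i' in simp)
          then show ?thesis using eq[OF x] eq[OF p_topspace[of "Suc i'" x]] x by simp
        qed
      qed
    qed
    from tensor_relations_add[OF continuous_functions_algebra r this] show ?thesis by simp
  qed
  \<comment> \<open>In \<open>remainder\<close> the factor with index \<open>k\<close> is applied
    last; since the projections commute it may be applied first, as here.\<close>
  then have "remainder (proj n) k (Poly_Mapping.single a 1 - proj n k (Poly_Mapping.single a 1)) \<in> relations n"
    unfolding tele remainder_sum by (intro tensor_relations_sum continuous_functions_algebra) auto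
  then show ?case by (simp only: remainder.simps remainder_diff proj_remainder_swap)
qed simp

text \<open>By linearity it suffices to treat pure tensors, where the induction starts with no slot
  fixed: all \<open>n\<close> slots are free and \<open>n < k\<close>.\<close>

lemma remainder_in_relations:
  assumes u: "u \<in> tensors n" and k: "n < k"
  shows "remainder (proj n) k u \<in> relations n"
proof -
  have "u = (\<Sum>a\<in>Poly_Mapping.keys u. Poly_Mapping.single a (Poly_Mapping.lookup u a))"
    using free_space_map_id[of u "\<lambda>a. a"] by (simp add: free_space_map_def)
  moreover have "Poly_Mapping.single a c = Poly_Mapping.map ((*) c) (Poly_Mapping.single a 1)"
    for a :: "nat \<Rightarrow> 'a \<Rightarrow> complex" and c :: complex
    by (rule poly_mapping_eqI) (simp add: lookup_single when_def)
  ultimately have "remainder (proj n) k u = (\<Sum>a\<in>Poly_Mapping.keys u.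
      Poly_Mapping.map ((*) (Poly_Mapping.lookup u a)) (remainder (proj n) k (Poly_Mapping.single a 1)))"
    by (metis (no_types, lifting) remainder_scale remainder_sum sum.cong)
  also have "\<dots> \<in> relations n"
    using u k by (intro tensor_relations_sum tensor_relations_scale continuous_functions_algebra
        remainder_fixed_slots[where M = "{}"]) (auto simp: free_space_def)
  finally show ?thesis .
qed

section \<open>The truncated transformation on formal sums\<close>

abbreviation transform :: "nat \<Rightarrow> nat \<Rightarrow> ((nat \<Rightarrow> 'a \<Rightarrow> complex) \<Rightarrow>\<^sub>0 complex) \<Rightarrow> ((nat \<Rightarrow> 'b \<Rightarrow> complex) \<Rightarrow>\<^sub>0 complex)" where
  "transform n \<equiv> twisted_sum (proj n) (twist n)"

lemma transform_linear: "linear_map class_ring (free_space (tuples (continuous_functions X) n))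
  (free_space (tuples (continuous_functions Y) n)) (transform n N)"
proof -
  interpret S: vectorspace class_ring "free_space (tuples (continuous_functions X) n)" by (rule free_space_vectorspace)
  interpret T: vectorspace class_ring "free_space (tuples (continuous_functions Y) n)" by (rule free_space_vectorspace)
  have "transform n N u \<in> tensors' n" if "u \<in> tensors n" for u
  proof -
    have "twist n k (remainder (proj n) k u) \<in> tensors' n" for k
      by (intro pullback_tensor_carrier[OF continuous_h'_Suc] remainder_tensors that)
    then have "(\<Union>k<N. Poly_Mapping.keys (twist n k (remainder (proj n) k u))) \<subseteq> tuples (continuous_functions Y) n"
      by (intro UN_least) (simp add: free_space_def)
    then have "Poly_Mapping.keys (transform n N u) \<subseteq> tuples (continuous_functions Y) n"
      unfolding twisted_sum_def using keys_sum by (rule order.trans[rotated])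
    then show ?thesis by (simp add: free_space_def)
  qed
  moreover have "transform n N (u + v) = transform n N u + transform n N v" for u v
    by (rule additive.add[OF additive_twisted_sum]) (rule additive_free_space_map)+
  moreover have "transform n N (Poly_Mapping.map ((*) c) u) = Poly_Mapping.map ((*) c) (transform n N u)" for c u
    by (simp add: twisted_sum_def remainder_scale free_space_map_scale map_scale_sum)
  ultimately show ?thesis
    by unfold_locales (auto simp: module_hom_def free_space_def)
qed

lemma transform_relations: "u \<in> relations n \<Longrightarrow> transform n N u \<in> relations' n"
  unfolding twisted_sum_def
  by (intro tensor_relations_sum continuous_functions_algebra pullback_tensor_relations[OF continuous_h'_Suc] remainder_relations)

text \<open>The extra summands have indices at least \<open>M\<close>, hence above \<open>n\<close>,
  and there the remainders are already relations.\<close>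

lemma transform_stable:
  assumes u: "u \<in> tensors n" and "n < M" "M \<le> N"
  shows "transform n N u - transform n M u \<in> relations' n"
proof -
  have "transform n N u - transform n M u = (\<Sum>k\<in>{..<N} - {..<M}. twist n k (remainder (proj n) k u))"
    using assms(3) by (subst sum_diff) (auto simp: twisted_sum_def)
  also have "\<dots> \<in> relations' n"
    using assms by (intro tensor_relations_sum continuous_functions_algebra
        pullback_tensor_relations[OF continuous_h'_Suc] remainder_in_relations) auto
  finally show ?thesis .
qed

text \<open>Fibre products commute with every pullback involved. The number \<open>N\<close> of
  summands is the same in degrees \<open>n\<close> and \<open>m\<close>;
  \<open>transform_stable\<close> reconciles different numbers later.\<close>

lemma transform_fibre_products:
  assumes u: "u \<in> tensors n"
  shows "free_space_map (fibre_products (continuous_functions Y) n m \<sigma>) (transform n N u) =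
    transform m N (free_space_map (fibre_products (continuous_functions X) n m \<sigma>) u)"
proof -
  let ?S = "free_space_map (fibre_products (continuous_functions X) n m \<sigma>)"
  have "?S (remainder (proj n) k u) = remainder (proj m) k (?S u)" for k
    by (rule remainder_intertwine[where C = "tensors n"])
      (auto intro: free_space_diff pullback_tensor_carrier continuous_p_Suc free_space_map_diff
        fibre_products_pullback_tensor u)
  then show ?thesis
    unfolding twisted_sum_def free_space_map_sum
    by (intro sum.cong refl)
      (simp add: fibre_products_pullback_tensor[OF continuous_h'_Suc remainder_tensors[OF u]])
qed

section \<open>The induced isomorphism of Loday functors\<close>

text \<open>Any number of summands greater than \<open>n\<close> induces the same map, see \<open>transform_stable\<close>.\<close>

definition Loday_transform :: "nat \<Rightarrow> ((nat \<Rightarrow> 'a \<Rightarrow> complex) \<Rightarrow>\<^sub>0 complex) set \<Rightarrow> ((nat \<Rightarrow> 'b \<Rightarrow> complex) \<Rightarrow>\<^sub>0 complex) set" where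
  "Loday_transform n =
    quotient_space_map (free_space (tuples (continuous_functions Y) n)) (relations' n) (transform n (Suc n))"

lemma Loday_transform_coset:
  assumes "u \<in> tensors n"
  shows "Loday_transform n (relations n +>\<^bsub>free_space (tuples (continuous_functions X) n)\<^esub> u) =
    relations' n +>\<^bsub>free_space (tuples (continuous_functions Y) n)\<^esub> transform n (Suc n) u"
  unfolding Loday_transform_def
  by (rule quotient_space_map_coset[OF transform_linear]) (use assms transform_relations in
    \<open>auto intro: tensor_relations_submodule continuous_functions_algebra\<close>)

lemma Loday_transform_linear:
  "linear_map class_ring (tensor_power (continuous_functions X) n) (tensor_power (continuous_functions Y) n) (Loday_transform n)"
  unfolding Loday_transform_def tensor_power_def
  by (rule quotient_space_map_linear[OF transform_linear]) (use transform_relations in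
    \<open>auto intro: tensor_relations_submodule continuous_functions_algebra\<close>)

lemma tensor_power_cosetE:
  assumes "v \<in> carrier (tensor_power (continuous_functions X) n)"
  obtains u where "u \<in> tensors n" "v = relations n +>\<^bsub>free_space (tuples (continuous_functions X) n)\<^esub> u"
  using assms
  unfolding tensor_power_def
    quotient_space_carrier[OF free_space_vectorspace tensor_relations_submodule[OF continuous_functions_algebra]]
  by blast

text \<open>The left factor is the transformation of the exchanged data. On formal sums the
  composite differs from the identity by the remainder of index \<open>Suc n\<close>, which is a
  relation in degree \<open>n\<close>.\<close>

lemma Loday_transform_inverse:
  assumes "v \<in> carrier (tensor_power (continuous_functions X) n)"
  shows "projections_and_twists.Loday_transform Y X q h n (Loday_transform n v) = v"
proof -
  interpret swap: projections_and_twists Y X q p h' h by (rule swap)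
  obtain u where u: "u \<in> tensors n" and v: "v = relations n +>\<^bsub>free_space (tuples (continuous_functions X) n)\<^esub> u"
    using tensor_power_cosetE[OF assms] .
  have t: "transform n (Suc n) u \<in> tensors' n" by (rule linear_map.T_im[OF transform_linear u])
  have "swap.transform n (Suc n) (transform n (Suc n) u) - u = - remainder (proj n) (Suc n) u"
    unfolding twisted_idempotents.twisted_sum_inverse[OF twisted_idempotents] by simp
  also have "\<dots> \<in> relations n"
    using tensor_relations_diff[OF continuous_functions_algebra tensor_relations_zero[OF continuous_functions_algebra]
        remainder_in_relations[OF u lessI]] by simp
  finally have "relations n +>\<^bsub>free_space (tuples (continuous_functions X) n)\<^esub> swap.transform n (Suc n) (transform n (Suc n) u) = v"
    unfolding v using u t by (intro tensor_coset_eqI continuous_functions_algebra linear_map.T_im[OF swap.transform_linear])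
  then show ?thesis by (simp only: v Loday_transform_coset[OF u] swap.Loday_transform_coset[OF t])
qed

lemma Loday_transform_natural:
  assumes \<sigma>: "\<sigma> \<in> surjections n m" and v: "v \<in> carrier (tensor_power (continuous_functions X) n)"
  shows "Loday_transform m (Ar (Loday (continuous_functions X)) n m \<sigma> v) =
    Ar (Loday (continuous_functions Y)) n m \<sigma> (Loday_transform n v)"
proof -
  let ?A = "continuous_functions X" and ?B = "continuous_functions Y"
  let ?S = "free_space_map (fibre_products ?A n m \<sigma>)" and ?T = "free_space_map (fibre_products ?B n m \<sigma>)"
  note A = continuous_functions_algebra
  obtain u where u: "u \<in> tensors n" and v: "v = relations n +>\<^bsub>free_space (tuples ?A n)\<^esub> u"
    using tensor_power_cosetE[OF v] .
  have S: "?S u \<in> tensors m"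
    by (rule linear_map.T_im[OF free_space_map_linear[OF fibre_products_tuples[OF A]] u])
  have t: "transform n (Suc n) u \<in> tensors' n" by (rule linear_map.T_im[OF transform_linear u])
  \<comment> \<open>Surjectivity makes \<open>Suc n\<close> summands enough in degree
    \<open>m\<close> too, so there \<open>Suc n\<close> and \<open>Suc m\<close> summands agree
    modulo relations.\<close>
  have "m \<le> n" using card_image_le[of "{1..n}" \<sigma>] \<sigma> by (simp add: surjections_def)
  then have "?T (transform n (Suc n) u) - transform m (Suc m) (?S u) \<in> relations' m"
    unfolding transform_fibre_products[OF u] by (intro transform_stable S) auto
  moreover have "?T (transform n (Suc n) u) \<in> tensors' m" "transform m (Suc m) (?S u) \<in> tensors' m"
    by (rule linear_map.T_im[OF free_space_map_linear[OF fibre_products_tuples[OF A]] t])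
      (rule linear_map.T_im[OF transform_linear S])
  ultimately have "relations' m +>\<^bsub>free_space (tuples ?B m)\<^esub> ?T (transform n (Suc n) u) =
      relations' m +>\<^bsub>free_space (tuples ?B m)\<^esub> transform m (Suc m) (?S u)"
    by (intro tensor_coset_eqI A)
  then show ?thesis
    unfolding v by (simp only: Loday_coset[OF A \<sigma> u] Loday_coset[OF A \<sigma> t] Loday_transform_coset[OF u] Loday_transform_coset[OF S])
qed

lemma natural_isomorphism_Loday_transform:
  "natural_isomorphism (Loday (continuous_functions X)) (Loday (continuous_functions Y)) Loday_transform"
proof -
  interpret swap: projections_and_twists Y X q p h' h by (rule swap)
  have "bij_betw (Loday_transform n) (carrier (tensor_power (continuous_functions X) n))
      (carrier (tensor_power (continuous_functions Y) n))" for n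
    using linear_map.T_im[OF Loday_transform_linear] linear_map.T_im[OF swap.Loday_transform_linear]
    \<comment> \<open>The inverse lemma, used for the given and for the exchanged data, gives both
      composites.\<close>
    by (intro bij_betw_byWitness[where f' = "swap.Loday_transform n"])
      (auto simp: Loday_transform_inverse swap.Loday_transform_inverse)
  then show ?thesis
    unfolding natural_isomorphism_def Ob_Loday using Loday_transform_linear Loday_transform_natural by blast
qed

end

theorem theorem8:
  fixes X :: "'a topology" and Y :: "'b topology"
  assumes "connected_by_projections_and_twists X Y"
  shows "isomorphic_functors (Loday (continuous_functions X)) (Loday (continuous_functions Y))"
proof -
  obtain p q h h' where "projections_and_twists X Y p q h h'"
    using assms unfolding connected_by_projections_and_twists_def by blast
  from projections_and_twists.natural_isomorphism_Loday_transform[OF this]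
  show ?thesis unfolding isomorphic_functors_def by (intro conjI exI Loday_continuous_functions)
qed

end
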